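(* Let $r\in\{0,1,2\}$ and let $k\ge 3$ be an integer, with $k\ge 4$ when $r=2$. Let $U_{k,r}$ be the unicyclic graph obtained from the tree $T_{3,k,k+r}$ by adding the edge $v_1a_{2,1}$. Then the independence polynomial $I(U_{k,r};x)$ is unimodal but not log-concave. More precisely, the penultimate log-concavity inequality fails: writing $I(U_{k,r};x)=\sum_{j=0}^{d}u_jx^j$ with $d=\alpha(U_{k,r})$, one has $u_{d-1}^2<u_{d-2}\,u_d$.
   Context: Graphs are finite and simple. For a graph $G$, $I(G;x)=\sum_{j=0}^{\alpha(G)}s_j(G)x^j$, where $s_j(G)$ is the number of independent sets of size $j$ and $\alpha(G)$ is the independence number. A polynomial with nonnegative coefficients $(a_0,\dots,a_d)$ is unimodal if $a_0\le\cdots\le a_m\ge\cdots\ge a_d$ for some $m$, and log-concave if $a_i^2\ge a_{i-1}a_{i+1}$ for $1\le i\le d-1$; the penultimate inequality is the one with $i=d-1$. For integers $m,n\ge 0$, the tree $T_{3,m,n}$ has a root $v_0$ with exactly three children $v_1,v_2,v_3$. A $P_2$-arm at a vertex $v$ is a path $v\,a\,b$ with edges $va$, $ab$ and new vertices $a,b$. The vertex $v_1$ carries three $P_2$-arms $v_1a_{1,j}b_{1,j}$ ($1\le j\le 3$), $v_2$ carries $m$ $P_2$-arms $v_2a_{2,j}b_{2,j}$ ($1\le j\le m$), and $v_3$ carries $n$ $P_2$-arms $v_3a_{3,j}b_{3,j}$ ($1\le j\le n$). There are no other vertices or edges. *)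

theory Defs
  imports "HOL-Computational_Algebra.Polynomial"
begin

record 'a graph =
  verts :: "'a set"
  edges :: "'a set set"

definition simple_graph :: "'a graph \<Rightarrow> bool" where
  "simple_graph G \<longleftrightarrow> finite (verts G) \<and> (\<forall>e\<in>edges G. e \<subseteq> verts G \<and> card e = 2)"

definition add_edge :: "'a graph \<Rightarrow> 'a \<Rightarrow> 'a \<Rightarrow> 'a graph" where
  "add_edge G u v = \<lparr>verts = verts G, edges = insert {u, v} (edges G)\<rparr>"

definition connected_graph :: "'a graph \<Rightarrow> bool" where
  "connected_graph G \<longleftrightarrow> verts G \<noteq> {} \<and>
     (\<forall>u\<in>verts G. \<forall>v\<in>verts G.
        (u, v) \<in> {(a, b). a \<in> verts G \<and> b \<in> verts G \<and> {a, b} \<in> edges G}\<^sup>*)"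

text \<open>A cycle is identified with its edge set: a nonempty finite set of edges that spans a
  connected 2-regular subgraph.\<close>

definition is_cycle :: "'a graph \<Rightarrow> 'a set set \<Rightarrow> bool" where
  "is_cycle G C \<longleftrightarrow> C \<subseteq> edges G \<and> C \<noteq> {} \<and> finite C \<and>
     connected_graph \<lparr>verts = \<Union>C, edges = C\<rparr> \<and>
     (\<forall>v\<in>\<Union>C. card {e\<in>C. v \<in> e} = 2)"

definition tree :: "'a graph \<Rightarrow> bool" where
  "tree G \<longleftrightarrow> connected_graph G \<and> (\<nexists>C. is_cycle G C)"

definition unicyclic :: "'a graph \<Rightarrow> bool" where
  "unicyclic G \<longleftrightarrow> connected_graph G \<and> (\<exists>!C. is_cycle G C)"

definition independent_set :: "'a graph \<Rightarrow> 'a set \<Rightarrow> bool" where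
  "independent_set G S \<longleftrightarrow> S \<subseteq> verts G \<and> (\<forall>u\<in>S. \<forall>v\<in>S. {u, v} \<notin> edges G)"

definition num_independent :: "'a graph \<Rightarrow> nat \<Rightarrow> nat" where
  "num_independent G j = card {S. independent_set G S \<and> card S = j}"

definition independence_number :: "'a graph \<Rightarrow> nat" where
  "independence_number G = Max {card S |S. independent_set G S}"

definition independence_poly :: "'a graph \<Rightarrow> int poly" where
  "independence_poly G =
     (\<Sum>j\<le>independence_number G. monom (int (num_independent G j)) j)"

text \<open>Both notions are meant for polynomials with nonnegative coefficients.\<close>

definition unimodal :: "int poly \<Rightarrow> bool" where
  "unimodal p \<longleftrightarrow> (\<exists>m\<le>degree p.
     (\<forall>i<m. coeff p i \<le> coeff p (i + 1)) \<and>
     (\<forall>i. m \<le> i \<and> i < degree p \<longrightarrow> coeff p (i + 1) \<le> coeff p i))"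

definition log_concave :: "int poly \<Rightarrow> bool" where
  "log_concave p \<longleftrightarrow>
     (\<forall>i. 1 \<le> i \<and> i < degree p \<longrightarrow> coeff p (i - 1) * coeff p (i + 1) \<le> (coeff p i)\<^sup>2)"

text \<open>\<open>Hub i\<close> is $v_i$ (the root is \<open>Hub 0\<close>), and \<open>Mid i j\<close>, \<open>Tip i j\<close> are the vertices
  $a_{i,j}$, $b_{i,j}$ of the $j$-th $P_2$-arm at $v_i$.\<close>

datatype vertex = Hub nat | Mid nat nat | Tip nat nat

definition arms :: "nat \<Rightarrow> nat \<Rightarrow> nat \<Rightarrow> nat" where
  "arms m n i = (if i = 1 then 3 else if i = 2 then m else n)"

definition T3 :: "nat \<Rightarrow> nat \<Rightarrow> vertex graph" where
  "T3 m n = \<lparr>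
     verts = {Hub i |i. i \<in> {0..3}}
           \<union> {Mid i j |i j. i \<in> {1..3} \<and> j \<in> {1..arms m n i}}
           \<union> {Tip i j |i j. i \<in> {1..3} \<and> j \<in> {1..arms m n i}},
     edges = {{Hub 0, Hub i} |i. i \<in> {1..3}}
           \<union> {{Hub i, Mid i j} |i j. i \<in> {1..3} \<and> j \<in> {1..arms m n i}}
           \<union> {{Mid i j, Tip i j} |i j. i \<in> {1..3} \<and> j \<in> {1..arms m n i}}\<rparr>"

definition U_graph :: "nat \<Rightarrow> nat \<Rightarrow> vertex graph" where
  "U_graph k r = add_edge (T3 k (k + r)) (Hub 1) (Mid 2 1)"

lemma finite_verts_T3: "finite (verts (T3 m n))"
proof -
  let ?I = "SIGMA i:{1..3}. {1..arms m n i}"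
  have "verts (T3 m n) = Hub ` {0..3} \<union> (\<lambda>(i, j). Mid i j) ` ?I \<union> (\<lambda>(i, j). Tip i j) ` ?I"
    by (fastforce simp: T3_def image_iff)
  then show ?thesis by simp
qed

lemma simple_graph_T3: "simple_graph (T3 m n)"
proof -
  have "e \<subseteq> verts (T3 m n) \<and> card e = 2" if "e \<in> edges (T3 m n)" for e
    using that by (auto simp: T3_def)
  then show ?thesis using finite_verts_T3[of m n] by (simp add: simple_graph_def)
qed

lemma simple_graph_U:
  assumes "k \<ge> 1"
  shows "simple_graph (U_graph k r)"
proof -
  have "{Hub 1, Mid 2 1} \<subseteq> verts (T3 k (k + r)) \<and> card {Hub 1, Mid 2 1} = 2"
    using assms by (auto simp: T3_def arms_def)
  then show ?thesis
    using simple_graph_T3[of k "k + r"] by (simp add: simple_graph_def U_graph_def add_edge_def)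
qed

lemma connected_graph_T3: "connected_graph (T3 m n)"
proof -
  let ?R = "{(a, b). a \<in> verts (T3 m n) \<and> b \<in> verts (T3 m n) \<and> {a, b} \<in> edges (T3 m n)}"
  have "sym ?R"
    by (auto simp: sym_def insert_commute)
  then have sym: "sym (?R\<^sup>*)" by (rule sym_rtrancl)
  have V: "(Hub 0, Hub i) \<in> ?R\<^sup>*" if "i \<le> 3" for i
  proof (cases "i = 0")
    case False
    then have "(Hub 0, Hub i) \<in> ?R" using that by (auto simp: T3_def)
    then show ?thesis by blast
  qed simp
  have A: "(Hub 0, Mid i j) \<in> ?R\<^sup>*" if "i \<in> {1..3}" "j \<in> {1..arms m n i}" for i j
  proof -
    have "(Hub i, Mid i j) \<in> ?R" using that by (auto simp: T3_def)
    moreover have "(Hub 0, Hub i) \<in> ?R\<^sup>*" using that V by simp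
    ultimately show ?thesis by (rule rtrancl_into_rtrancl[rotated])
  qed
  have B: "(Hub 0, Tip i j) \<in> ?R\<^sup>*" if "i \<in> {1..3}" "j \<in> {1..arms m n i}" for i j
  proof -
    have "(Mid i j, Tip i j) \<in> ?R" using that by (auto simp: T3_def)
    with A[OF that] show ?thesis by (rule rtrancl_into_rtrancl)
  qed
  have root: "(Hub 0, v) \<in> ?R\<^sup>*" if "v \<in> verts (T3 m n)" for v
  proof -
    consider i where "i \<le> 3" "v = Hub i"
      | i j where "i \<in> {1..3}" "j \<in> {1..arms m n i}" "v = Mid i j \<or> v = Tip i j"
      using \<open>v \<in> verts (T3 m n)\<close> unfolding T3_def by auto
    then show ?thesis using V A B by cases blast+
  qed
  have "(u, v) \<in> ?R\<^sup>*" if "u \<in> verts (T3 m n)" "v \<in> verts (T3 m n)" for u v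
    using root[OF that(1)] root[OF that(2)] sym by (meson rtrancl_trans symD)
  moreover have "verts (T3 m n) \<noteq> {}" by (auto simp: T3_def)
  ultimately show ?thesis unfolding connected_graph_def by blast
qed

lemma connected_graph_U: "connected_graph (U_graph k r)"
proof -
  let ?G = "T3 k (k + r)"
  have "{(a, b). a \<in> verts ?G \<and> b \<in> verts ?G \<and> {a, b} \<in> edges ?G}\<^sup>*
      \<subseteq> {(a, b). a \<in> verts (U_graph k r) \<and> b \<in> verts (U_graph k r) \<and> {a, b} \<in> edges (U_graph k r)}\<^sup>*"
    by (intro rtrancl_mono) (auto simp: U_graph_def add_edge_def)
  moreover have "verts (U_graph k r) = verts ?G" by (simp add: U_graph_def add_edge_def)
  ultimately show ?thesis
    using connected_graph_T3[of k "k + r"] unfolding connected_graph_def by auto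
qed

definition four_cycle :: "vertex set set" where
  "four_cycle = {{Hub 0, Hub 1}, {Hub 1, Mid 2 1}, {Hub 2, Mid 2 1}, {Hub 0, Hub 2}}"

lemma cycle_eq_four_cycle:
  assumes "is_cycle G C" and sub: "edges G \<subseteq> insert {Hub 1, Mid 2 1} (edges (T3 m n))"
  shows "C = four_cycle"
proof -
  have CE: "C \<subseteq> insert {Hub 1, Mid 2 1} (edges (T3 m n))" and ne: "C \<noteq> {}"
    and deg: "\<And>v. v \<in> \<Union>C \<Longrightarrow> card {e\<in>C. v \<in> e} = 2"
    using assms by (auto simp: is_cycle_def)
  have other: "\<exists>e'\<in>C. e' \<noteq> e \<and> v \<in> e'" if "e \<in> C" "v \<in> e" for e v
  proof (rule ccontr)
    assume "\<not> ?thesis"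
    with that have "{e\<in>C. v \<in> e} = {e}" by auto
    with deg[of v] that show False by auto
  qed
  have noB: "{Mid i j, Tip i j} \<notin> C" for i j
  proof
    assume "{Mid i j, Tip i j} \<in> C"
    from other[OF this, of "Tip i j"] obtain e where
      "e \<in> C" "e \<noteq> {Mid i j, Tip i j}" "Tip i j \<in> e" by auto
    with CE show False by (auto simp: T3_def)
  qed
  have noA: "{Hub i, Mid i j} \<notin> C" if "(i, j) \<noteq> (2, 1)" for i j
  proof
    assume "{Hub i, Mid i j} \<in> C"
    from other[OF this, of "Mid i j"] obtain e where
      "e \<in> C" "e \<noteq> {Hub i, Mid i j}" "Mid i j \<in> e" by auto
    with CE noB that show False by (auto simp: T3_def)
  qed
  have ec: "e = {Hub 1, Mid 2 1} \<or> (\<exists>i\<in>{1..3}. e = {Hub 0, Hub i}) \<or> (\<exists>i j. e = {Hub i, Mid i j}) \<or>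
      (\<exists>i j. e = {Mid i j, Tip i j})" if "e \<in> C" for e
    using subsetD[OF CE that] unfolding T3_def by auto
  have noV: "{Hub 0, Hub 3} \<notin> C"
  proof
    assume "{Hub 0, Hub 3} \<in> C"
    from other[OF this, of "Hub 3"] obtain e where
      e: "e \<in> C" "e \<noteq> {Hub 0, Hub 3}" "Hub 3 \<in> e" by auto
    with ec[OF e(1)] obtain j where "e = {Hub 3, Mid 3 j}" by fastforce
    with e noA[of 3 j] show False by auto
  qed
  have C4: "C \<subseteq> four_cycle"
  proof
    fix e assume e: "e \<in> C"
    from ec[OF e] consider "e = {Hub 1, Mid 2 1}" | i where "i \<in> {1..3}" "e = {Hub 0, Hub i}"
      | i j where "e = {Hub i, Mid i j}" | i j where "e = {Mid i j, Tip i j}"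
      by blast
    then show "e \<in> four_cycle"
    proof cases
      case (2 i)
      then have "i = 1 \<or> i = 2 \<or> i = 3" by auto
      with 2 e noV show ?thesis by (elim disjE) (simp_all add: four_cycle_def)
    next
      case (3 i j)
      with e noA[of i j] have "i = 2" "j = 1" by auto
      with 3 show ?thesis by (simp add: four_cycle_def)
    next
      case 4
      with e noB show ?thesis by blast
    qed (simp add: four_cycle_def)
  qed
  have other4: "\<exists>e'\<in>four_cycle. e' \<in> C \<and> e' \<noteq> e \<and> v \<in> e'" if "e \<in> C" "v \<in> e" for e v
    using other[OF that] C4 by blast
  have s1: "{Hub 1, Mid 2 1} \<in> C" if "{Hub 0, Hub 1} \<in> C"
    using other4[OF that, of "Hub 1"] by (simp add: four_cycle_def)
  have s2: "{Hub 2, Mid 2 1} \<in> C" if "{Hub 1, Mid 2 1} \<in> C"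
    using other4[OF that, of "Mid 2 1"] by (simp add: four_cycle_def)
  have s3: "{Hub 0, Hub 2} \<in> C" if "{Hub 2, Mid 2 1} \<in> C"
    using other4[OF that, of "Hub 2"] by (simp add: four_cycle_def)
  have s4: "{Hub 0, Hub 1} \<in> C" if "{Hub 0, Hub 2} \<in> C"
    using other4[OF that, of "Hub 0"] by (simp add: four_cycle_def)
  from ne obtain e where e: "e \<in> C" by blast
  with C4 have "e = {Hub 0, Hub 1} \<or> e = {Hub 1, Mid 2 1} \<or> e = {Hub 2, Mid 2 1} \<or> e = {Hub 0, Hub 2}"
    by (auto simp only: four_cycle_def)
  with e s2 s3 s4 have "{Hub 0, Hub 1} \<in> C" by metis
  with s1 s2 s3 have "four_cycle \<subseteq> C" by (simp add: four_cycle_def)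
  with C4 show ?thesis by (rule subset_antisym)
qed

lemma is_cycle_four_cycle:
  assumes "four_cycle \<subseteq> edges G"
  shows "is_cycle G four_cycle"
proof -
  let ?R = "{(a, b). a \<in> \<Union>four_cycle \<and> b \<in> \<Union>four_cycle \<and> {a, b} \<in> four_cycle}"
  have ne: "four_cycle \<noteq> {}" "finite four_cycle" by (simp_all add: four_cycle_def)
  have Un: "\<Union>four_cycle = {Hub 0, Hub 1, Hub 2, Mid 2 1}" by (auto simp: four_cycle_def)
  have "sym ?R"
    by (auto simp: sym_def insert_commute)
  then have sym: "sym (?R\<^sup>*)" by (rule sym_rtrancl)
  have 1: "(Hub 0, Hub 1) \<in> ?R\<^sup>*" "(Hub 0, Hub 2) \<in> ?R\<^sup>*"
    by (auto intro!: r_into_rtrancl simp: four_cycle_def)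
  have "(Hub 1, Mid 2 1) \<in> ?R" by (auto simp: four_cycle_def)
  with 1(1) have "(Hub 0, Mid 2 1) \<in> ?R\<^sup>*" by (rule rtrancl_into_rtrancl)
  with 1 have root: "(Hub 0, v) \<in> ?R\<^sup>*" if "v \<in> \<Union>four_cycle" for v
    using that unfolding Un by blast
  have "(u, v) \<in> ?R\<^sup>*" if "u \<in> \<Union>four_cycle" "v \<in> \<Union>four_cycle" for u v
    using root[OF that(1)] root[OF that(2)] sym by (meson rtrancl_trans symD)
  then have "connected_graph \<lparr>verts = \<Union>four_cycle, edges = four_cycle\<rparr>"
    unfolding connected_graph_def using Un by simp
  moreover have "card {e\<in>four_cycle. v \<in> e} = 2" if "v \<in> \<Union>four_cycle" for v
  proof -
    have eqs: "{e\<in>four_cycle. Hub 0 \<in> e} = {{Hub 0, Hub 1}, {Hub 0, Hub 2}}"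
      "{e\<in>four_cycle. Hub 1 \<in> e} = {{Hub 0, Hub 1}, {Hub 1, Mid 2 1}}"
      "{e\<in>four_cycle. Hub 2 \<in> e} = {{Hub 2, Mid 2 1}, {Hub 0, Hub 2}}"
      "{e\<in>four_cycle. Mid 2 1 \<in> e} = {{Hub 1, Mid 2 1}, {Hub 2, Mid 2 1}}"
      by (auto simp: four_cycle_def)
    then show ?thesis
      using that unfolding Un
      by (elim insertE emptyE) (simp_all only: eqs, simp_all add: doubleton_eq_iff)
  qed
  ultimately show ?thesis
    using assms ne unfolding is_cycle_def by blast
qed

lemma tree_T3: "tree (T3 m n)"
proof -
  have "\<not> is_cycle (T3 m n) C" for C
  proof
    assume C: "is_cycle (T3 m n) C"
    then have "C = four_cycle" by (rule cycle_eq_four_cycle) auto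
    with C have "{Hub 1, Mid 2 1} \<in> edges (T3 m n)" by (auto simp: is_cycle_def four_cycle_def)
    then show False by (auto simp: T3_def doubleton_eq_iff)
  qed
  then show ?thesis by (simp add: tree_def connected_graph_T3)
qed

lemma unicyclic_U:
  assumes "k \<ge> 1"
  shows "unicyclic (U_graph k r)"
proof -
  have "{Hub 0, Hub i} \<in> edges (T3 k (k + r))" if "i \<in> {1..3}" for i
    using that unfolding T3_def by auto
  from this[of 1] this[of 2] have "{Hub 0, Hub 1} \<in> edges (T3 k (k + r))"
    "{Hub 0, Hub 2} \<in> edges (T3 k (k + r))" by simp_all
  moreover have "{Hub i, Mid i j} \<in> edges (T3 k (k + r))"
    if "i \<in> {1..3}" "j \<in> {1..arms k (k + r) i}" for i j
    using that unfolding T3_def by auto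
  from this[of 2 1] have "{Hub 2, Mid 2 1} \<in> edges (T3 k (k + r))"
    using assms by (simp add: arms_def)
  ultimately have "four_cycle \<subseteq> edges (U_graph k r)"
    by (simp add: four_cycle_def U_graph_def add_edge_def)
  moreover have "C = four_cycle" if "is_cycle (U_graph k r) C" for C
    using that by (rule cycle_eq_four_cycle) (auto simp: U_graph_def add_edge_def)
  ultimately show ?thesis
    using is_cycle_four_cycle connected_graph_U unfolding unicyclic_def by blast
qed

lemma independent_card_le:
  assumes "finite (verts G)" "independent_set G S"
  shows "card S \<le> independence_number G"
proof -
  have "{card S |S. independent_set G S} \<subseteq> card ` Pow (verts G)"
    by (auto simp: independent_set_def)
  then have "finite {card S |S. independent_set G S}"
    using assms(1) by (meson finite_Pow_iff finite_imageI finite_subset)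
  then show ?thesis
    unfolding independence_number_def using assms(2) by (intro Max_ge) auto
qed

lemma independence_number_attained:
  assumes "finite (verts G)"
  obtains S where "independent_set G S" "card S = independence_number G"
proof -
  have "{card S |S. independent_set G S} \<subseteq> card ` Pow (verts G)"
    by (auto simp: independent_set_def)
  then have fin: "finite {card S |S. independent_set G S}"
    using assms(1) by (meson finite_Pow_iff finite_imageI finite_subset)
  have "independent_set G {}" by (simp add: independent_set_def)
  then have "{card S |S. independent_set G S} \<noteq> {}" by blast
  from Max_in[OF fin this] that show thesis
    unfolding independence_number_def by auto
qed

lemma coeff_independence_poly:
  assumes "finite (verts G)"
  shows "coeff (independence_poly G) j = int (num_independent G j)"
proof (cases "j \<le> independence_number G")
  case True
  then show ?thesis by (simp add: independence_poly_def coeff_sum)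
next
  case False
  with independent_card_le[OF assms] have "{S. independent_set G S \<and> card S = j} = {}" by auto
  then have "num_independent G j = 0" by (simp only: num_independent_def card.empty)
  with False show ?thesis by (simp add: independence_poly_def coeff_sum)
qed

lemma degree_independence_poly:
  assumes "finite (verts G)"
  shows "degree (independence_poly G) = independence_number G"
proof (rule antisym)
  show "degree (independence_poly G) \<le> independence_number G"
    unfolding independence_poly_def by (intro degree_sum_le) (auto intro: order.trans[OF degree_monom_le])
  obtain S where S: "independent_set G S" "card S = independence_number G"
    using independence_number_attained[OF assms] .
  let ?F = "{S. independent_set G S \<and> card S = independence_number G}"
  have "?F \<subseteq> Pow (verts G)" by (auto simp: independent_set_def)
  then have "finite ?F" using assms by (meson finite_Pow_iff finite_subset)
  with S have "card ?F \<noteq> 0" by auto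
  then show "independence_number G \<le> degree (independence_poly G)"
    by (intro le_degree) (simp add: coeff_independence_poly[OF assms] num_independent_def)
qed

lemma independence_number_U: "independence_number (U_graph k r) \<ge> 2"
proof -
  have "independent_set (U_graph k r) {Hub 0, Mid 1 1}"
    by (auto simp: independent_set_def U_graph_def add_edge_def T3_def arms_def doubleton_eq_iff)
  moreover have "finite (verts (U_graph k r))"
    by (simp add: U_graph_def add_edge_def finite_verts_T3)
  ultimately have "card {Hub 0, Mid 1 1} \<le> independence_number (U_graph k r)"
    by (intro independent_card_le)
  then show ?thesis by simp
qed

end

theory Submission
  imports Defs
begin

text \<open>
  With \<open>E = 1 + 2 x\<close>, \<open>Q = 1 + x\<close>, \<open>n = k + r\<close> and \<open>N = k + n\<close>, branching on the hubs gives
  \<open>I(U) = E^(N+3) Q + x E^(N-1) Q^4 + x E^(k+3) Q^n + x^2 E^(k-1) Q^(n+4) + x E^(n+3) Q^k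
    + x^2 E^n Q^(k+3) + x^2 E^3 Q^N + x^3 Q^(N+3)\<close>.
  The three leading coefficients of this sum yield the penultimate failure: they are \<open>1\<close>,
  about \<open>2^n + 2^(k-1)\<close>, and at least \<open>17 * 2^(N-1)\<close>.

  The coefficients of \<open>E^a Q^b\<close> are log-concave and satisfy a three-term recurrence; together
  these place the mode at \<open>(4 a + 3 b) / 6\<close> up to rounding. The first two summands both rise
  up to \<open>m = (2 N + 7) div 3\<close> and fall from \<open>m + 1\<close> on, and the direction of the single step
  from \<open>m\<close> to \<open>m + 1\<close> is irrelevant for unimodality. The other six summands peak earlier,
  but to the right of index \<open>N / 2 + 4\<close> their coefficients are at most a multiple
  \<open>(3/4)^k\<close> of those of \<open>E^(N+3)\<close>, which for \<open>k \<ge> 10\<close> is less than the growth of the first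
  summand. The finitely many cases \<open>k < 10\<close> are computed.
\<close>

section \<open>Generating functions of independent sets\<close>

text \<open>The edge set stays fixed while the vertex set varies, so deleting vertices in a
  branching never produces a new graph.\<close>

definition indep_gf :: "'a set set \<Rightarrow> 'a set \<Rightarrow> int poly" where
  "indep_gf E V = (\<Sum>S | S \<subseteq> V \<and> (\<forall>u\<in>S. \<forall>v\<in>S. {u, v} \<notin> E). monom 1 (card S))"

lemma independence_poly_eq_indep_gf:
  assumes "finite (verts G)"
  shows "independence_poly G = indep_gf (edges G) (verts G)"
proof (rule poly_eqI)
  fix j
  let ?F = "{S. S \<subseteq> verts G \<and> (\<forall>u\<in>S. \<forall>v\<in>S. {u, v} \<notin> edges G)}"
  have fin: "finite ?F" using assms by simp
  have "coeff (indep_gf (edges G) (verts G)) j = (\<Sum>S\<in>?F. if card S = j then 1 else 0)"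
    by (simp add: indep_gf_def coeff_sum)
  also have "\<dots> = int (card {S\<in>?F. card S = j})"
    using fin by (simp add: sum.If_cases Int_def)
  also have "{S\<in>?F. card S = j} = {S. independent_set G S \<and> card S = j}"
    by (auto simp: independent_set_def)
  finally show "coeff (independence_poly G) j = coeff (indep_gf (edges G) (verts G)) j"
    by (simp add: coeff_independence_poly[OF assms] num_independent_def)
qed

lemma indep_gf_empty [simp]: "indep_gf E {} = 1"
proof -
  have "{S. S \<subseteq> {} \<and> (\<forall>u\<in>S. \<forall>v\<in>S. {u, v} \<notin> E)} = {{}}" by auto
  then show ?thesis by (simp add: indep_gf_def monom_0 one_pCons del: subset_empty)
qed

text \<open>Split the independent sets by whether they contain \<open>v\<close>; those that do arise
  from independent subsets of the non-neighbours \<open>W'\<close>, and the extra vertex gives the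
  factor \<open>x\<close>.\<close>

lemma indep_gf_insert:
  assumes "finite W" "v \<notin> W" "{v} \<notin> E" and W': "W' = {w\<in>W. {v, w} \<notin> E}"
  shows "indep_gf E (insert v W) = indep_gf E W + [:0, 1:] * indep_gf E W'"
proof -
  let ?F = "\<lambda>V. {S. S \<subseteq> V \<and> (\<forall>u\<in>S. \<forall>v\<in>S. {u, v} \<notin> E)}"
  have fin: "finite (?F W)" "finite (?F W')" using assms by auto
  have "?F (insert v W) \<subseteq> ?F W \<union> insert v ` ?F W'"
  proof
    fix S assume S: "S \<in> ?F (insert v W)"
    show "S \<in> ?F W \<union> insert v ` ?F W'"
    proof (cases "v \<in> S")
      case True
      then have "S = insert v (S - {v})" by auto
      moreover have "S - {v} \<in> ?F W'" using S True by (auto simp: W')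
      ultimately show ?thesis by blast
    qed (use S in auto)
  qed
  moreover have "insert v S \<in> ?F (insert v W)" if "S \<in> ?F W'" for S
    using that assms by (auto simp: insert_commute)
  moreover have "?F W \<subseteq> ?F (insert v W)" by auto
  ultimately have eq: "?F (insert v W) = ?F W \<union> insert v ` ?F W'"
    by (intro subset_antisym Un_least image_subsetI)
  have inj: "inj_on (insert v) (?F W')"
  proof (rule inj_onI)
    fix S T assume "S \<in> ?F W'" "T \<in> ?F W'" "insert v S = insert v T"
    moreover from this have "v \<notin> S" "v \<notin> T" using \<open>v \<notin> W\<close> by (auto simp: W')
    ultimately show "S = T" using insert_ident by metis
  qed
  have card: "monom 1 (card (insert v S)) = [:0, 1:] * (monom 1 (card S) :: int poly)" if "S \<in> ?F W'" for S
  proof -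
    have "S \<subseteq> W" "v \<notin> S" using that \<open>v \<notin> W\<close> by (auto simp: W')
    moreover from this have "finite S" using \<open>finite W\<close> finite_subset by blast
    ultimately show ?thesis by (simp add: monom_Suc)
  qed
  have "indep_gf E (insert v W) = indep_gf E W + (\<Sum>S\<in>insert v ` ?F W'. monom 1 (card S))"
    unfolding indep_gf_def eq using fin \<open>v \<notin> W\<close> by (intro sum.union_disjoint) auto
  also have "(\<Sum>S\<in>insert v ` ?F W'. monom 1 (card S)) = [:0, 1:] * indep_gf E W'"
    unfolding indep_gf_def sum_distrib_left sum.reindex[OF inj] o_def
    by (rule sum.cong[OF refl]) (rule card)
  finally show ?thesis .
qed

text \<open>Intersecting with \<open>A\<close> and with \<open>B\<close> is a bijection onto pairs
  of independent sets, and sizes add.\<close>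

lemma indep_gf_Un:
  assumes "finite A" "finite B" "A \<inter> B = {}" and no_edge: "\<And>a b. a \<in> A \<Longrightarrow> b \<in> B \<Longrightarrow> {a, b} \<notin> E"
  shows "indep_gf E (A \<union> B) = indep_gf E A * indep_gf E B"
proof -
  let ?F = "\<lambda>V. {S. S \<subseteq> V \<and> (\<forall>u\<in>S. \<forall>v\<in>S. {u, v} \<notin> E)}"
  have no_edge': "{b, a} \<notin> E" if "a \<in> A" "b \<in> B" for a b
    using no_edge[OF that] by (simp add: insert_commute)
  have "indep_gf E A * indep_gf E B
      = (\<Sum>(S, T)\<in>?F A \<times> ?F B. monom 1 (card S) * monom 1 (card T))"
    by (simp add: indep_gf_def sum_product sum.cartesian_product)
  also have "\<dots> = indep_gf E (A \<union> B)"
    unfolding indep_gf_def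
  proof (rule sum.reindex_bij_witness[of _ "\<lambda>S. (S \<inter> A, S \<inter> B)" "\<lambda>(S, T). S \<union> T"])
    fix ST assume ST: "ST \<in> ?F A \<times> ?F B"
    obtain S T where [simp]: "ST = (S, T)" by (cases ST)
    have sub: "S \<subseteq> A" "T \<subseteq> B" using ST by auto
    then have "finite S" "finite T" "S \<inter> T = {}"
      using assms finite_subset by blast+
    then show "monom 1 (card (case ST of (S, T) \<Rightarrow> S \<union> T))
        = (case ST of (S, T) \<Rightarrow> monom 1 (card S) * monom (1::int) (card T))"
      by (simp add: mult_monom card_Un_disjoint)
    show "((case ST of (S, T) \<Rightarrow> S \<union> T) \<inter> A, (case ST of (S, T) \<Rightarrow> S \<union> T) \<inter> B) = ST"
      using sub \<open>A \<inter> B = {}\<close> by auto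
    have "{u, v} \<notin> E" "{v, u} \<notin> E" if "u \<in> S" "v \<in> T" for u v
      using that sub no_edge no_edge' by blast+
    then show "(case ST of (S, T) \<Rightarrow> S \<union> T) \<in> ?F (A \<union> B)"
      using ST by auto
  qed auto
  finally show ?thesis ..
qed


section \<open>Adjacency in \<open>U_graph\<close> and the factors contributed by arms\<close>

lemma edges_U_iff:
  fixes k r :: nat
  defines "E \<equiv> edges (U_graph k r)"
  shows "{Hub i, Hub i'} \<in> E \<longleftrightarrow> i = 0 \<and> i' \<in> {1..3} \<or> i' = 0 \<and> i \<in> {1..3}"
    and "{Hub i, Mid i' j} \<in> E \<longleftrightarrow>
      i = i' \<and> i \<in> {1..3} \<and> j \<in> {1..arms k (k + r) i} \<or> i = 1 \<and> i' = 2 \<and> j = 1"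
    and "{Mid i j, Tip i' j'} \<in> E \<longleftrightarrow>
      i = i' \<and> j = j' \<and> i \<in> {1..3} \<and> j \<in> {1..arms k (k + r) i}"
    and "{Hub i, Tip i' j} \<notin> E" "{Mid i j, Mid i' j'} \<notin> E" "{Tip i j, Tip i' j'} \<notin> E"
  by (auto simp: E_def U_graph_def add_edge_def T3_def doubleton_eq_iff)

lemma edges_U_sym_iff:
  fixes k r :: nat
  defines "E \<equiv> edges (U_graph k r)"
  shows "{Mid i' j, Hub i} \<in> E \<longleftrightarrow> {Hub i, Mid i' j} \<in> E"
    and "{Tip i' j', Mid i j} \<in> E \<longleftrightarrow> {Mid i j, Tip i' j'} \<in> E"
    and "{Tip i' j, Hub i} \<in> E \<longleftrightarrow> {Hub i, Tip i' j} \<in> E"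
    and "{Hub i} \<notin> E" "{Mid i j} \<notin> E" "{Tip i j} \<notin> E"
  using edges_U_iff[of i i k r] edges_U_iff(5,6)[of i j i j k r]
  by (simp_all add: E_def insert_commute)

lemmas edges_U = edges_U_iff edges_U_sym_iff

lemma indep_gf_tips:
  assumes "finite J"
  shows "indep_gf (edges (U_graph k r)) (Tip i ` J) = [:1, 1:] ^ card J"
  using assms
proof induction
  case (insert j J)
  have "indep_gf (edges (U_graph k r)) (insert (Tip i j) (Tip i ` J))
      = indep_gf (edges (U_graph k r)) (Tip i ` J)
        + [:0, 1:] * indep_gf (edges (U_graph k r)) (Tip i ` J)"
    using insert by (intro indep_gf_insert) (auto simp: edges_U)
  also have "\<dots> = [:1, 1:] * indep_gf (edges (U_graph k r)) (Tip i ` J)"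
    by simp
  finally show ?case using insert by simp
qed simp

lemma indep_gf_arms:
  assumes "J \<subseteq> {1..arms k (k + r) i}" "i \<in> {1..3}"
  shows "indep_gf (edges (U_graph k r)) (Mid i ` J \<union> Tip i ` J) = [:1, 2:] ^ card J"
proof -
  let ?g = "indep_gf (edges (U_graph k r))"
  have arm: "?g {Mid i j, Tip i j} = [:1, 2:]" if "j \<in> {1..arms k (k + r) i}" for j
  proof -
    have "?g {Mid i j, Tip i j} = ?g {Tip i j} + [:0, 1:] * ?g {}"
      by (rule indep_gf_insert) (use that assms(2) in \<open>auto simp: edges_U\<close>)
    moreover have "?g {Tip i j} = ?g {} + [:0, 1:] * ?g {}"
      by (rule indep_gf_insert) (auto simp: edges_U)
    ultimately show ?thesis
      by (simp add: one_pCons)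
  qed
  have "finite J" using assms(1) finite_subset by blast
  then show ?thesis using assms(1)
  proof induction
    case (insert j J)
    have "Mid i ` insert j J \<union> Tip i ` insert j J = {Mid i j, Tip i j} \<union> (Mid i ` J \<union> Tip i ` J)"
      by auto
    also have "?g \<dots> = ?g {Mid i j, Tip i j} * ?g (Mid i ` J \<union> Tip i ` J)"
      by (rule indep_gf_Un) (use insert.hyps in \<open>auto simp: edges_U\<close>)
    finally show ?case using insert arm by simp
  qed simp
qed

section \<open>Coefficients of products of linear factors\<close>

text \<open>Integer indices make shifts by powers of \<open>x\<close> free of case distinctions.\<close>
definition icoeff :: "int poly \<Rightarrow> int \<Rightarrow> int" where
  "icoeff p i = (if i < 0 then 0 else coeff p (nat i))"

lemma coeff_eq_icoeff: "coeff p i = icoeff p (int i)"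
  by (simp add: icoeff_def)

lemma icoeff_add: "icoeff (p + q) i = icoeff p i + icoeff q i"
  by (simp add: icoeff_def)

lemma icoeff_one: "icoeff 1 i = (if i = 0 then 1 else 0)"
  by (simp add: icoeff_def)

lemma icoeff_linear_mult: "icoeff ([:1, c:] * p) i = icoeff p i + c * icoeff p (i - 1)"
proof -
  have "nat i = Suc (nat (i - 1))" if "i > 0" using that by simp
  then show ?thesis by (auto simp: icoeff_def coeff_pCons split: nat.splits)
qed

lemma icoeff_monom_mult: "icoeff (monom 1 s * p) i = icoeff p (i - int s)"
proof -
  have "nat (i - int s) = nat i - s" "int s \<le> i \<longleftrightarrow> s \<le> nat i" if "i \<ge> 0" using that by auto
  then show ?thesis by (auto simp: icoeff_def coeff_monom_mult not_less)
qed

definition lin_prod :: "nat \<Rightarrow> nat \<Rightarrow> int poly" where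
  "lin_prod a b = [:1, 2:] ^ a * [:1, 1:] ^ b"

lemma lin_prod_0: "lin_prod 0 0 = 1"
  and lin_prod_Suc1: "lin_prod (Suc a) b = [:1, 2:] * lin_prod a b"
  and lin_prod_Suc2: "lin_prod a (Suc b) = [:1, 1:] * lin_prod a b"
  by (simp_all only: lin_prod_def power_Suc power_0 mult_1 mult.assoc mult.left_commute)

lemma icoeff_lin_prod_Suc1:
  "icoeff (lin_prod (Suc a) b) i = icoeff (lin_prod a b) i + 2 * icoeff (lin_prod a b) (i - 1)"
  by (simp only: lin_prod_Suc1 icoeff_linear_mult)

lemma icoeff_lin_prod_Suc2:
  "icoeff (lin_prod a (Suc b)) i = icoeff (lin_prod a b) i + icoeff (lin_prod a b) (i - 1)"
  by (simp only: lin_prod_Suc2 icoeff_linear_mult mult_1)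

text \<open>The polynomial is an argument of \<open>P\<close>, so an induction step sees an
  arbitrary \<open>p\<close> times one linear factor instead of powers.\<close>

lemma lin_prod_induct [case_names one Suc1 Suc2]:
  assumes "P 0 0 1"
    and "\<And>a b p. P a b p \<Longrightarrow> P (Suc a) b ([:1, 2:] * p)"
    and "\<And>a b p. P a b p \<Longrightarrow> P a (Suc b) ([:1, 1:] * p)"
  shows "P a b (lin_prod a b)"
proof (induction b)
  case 0
  show ?case
    by (induction a) (simp_all only: lin_prod_0 lin_prod_Suc1 assms)
next
  case (Suc b)
  then show ?case by (simp only: lin_prod_Suc2 assms)
qed

section \<open>Log-concavity, recurrence and position of the mode\<close>

lemma icoeff_lin_prod_nonneg: "icoeff (lin_prod a b) i \<ge> 0"
proof -
  let ?P = "\<lambda>p. \<forall>i. icoeff p i \<ge> 0"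
  have step: "?P ([:1, c:] * p)" if "?P p" "c \<ge> 0" for p c
    using that by (simp only: icoeff_linear_mult) simp
  have "?P (lin_prod a b)"
    by (rule lin_prod_induct) (simp add: icoeff_one, (rule step; simp)+)
  then show ?thesis by blast
qed

text \<open>After expansion the terms \<open>c * f (i - 1) * f j\<close> cancel and the others
  compare power by power in \<open>c\<close>. Assuming the inequality for all
  \<open>i \<le> j\<close>, not only \<open>i = j\<close>, avoids division by coefficients that may
  vanish.\<close>

lemma log_concave_linear_mult:
  fixes f :: "int \<Rightarrow> int"
  assumes nonneg: "\<And>i. f i \<ge> 0" and "c \<ge> 0" and "i \<le> j"
    and lc: "\<And>i j. i \<le> j \<Longrightarrow> f (i - 1) * f (j + 1) \<le> f i * f j"
  shows "(f (i - 1) + c * f (i - 2)) * (f (j + 1) + c * f j)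
    \<le> (f i + c * f (i - 1)) * (f j + c * f (j - 1))"
proof -
  have "f (i - 2) * f (j + 1) \<le> f (i - 1) * f j"
    using lc[of "i - 1" j] \<open>i \<le> j\<close> by simp
  also have "f (i - 1) * f j \<le> f i * f (j - 1)"
    using lc[of i "j - 1"] \<open>i \<le> j\<close> by (cases "i = j") (simp_all add: mult.commute)
  finally have "c * (f (i - 2) * f (j + 1)) \<le> c * (f i * f (j - 1))"
    using \<open>c \<ge> 0\<close> by (rule mult_left_mono)
  moreover have "c * c * (f (i - 2) * f j) \<le> c * c * (f (i - 1) * f (j - 1))"
    using lc[of "i - 1" "j - 1"] \<open>i \<le> j\<close> \<open>c \<ge> 0\<close> by (intro mult_left_mono) simp_all
  moreover have "f (i - 1) * f (j + 1) \<le> f i * f j"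
    using lc \<open>i \<le> j\<close> .
  ultimately show ?thesis by (simp add: algebra_simps)
qed

lemma icoeff_lin_prod_log_concave:
  assumes "i \<le> j"
  shows "icoeff (lin_prod a b) (i - 1) * icoeff (lin_prod a b) (j + 1)
    \<le> icoeff (lin_prod a b) i * icoeff (lin_prod a b) j"
proof -
  let ?P = "\<lambda>p. (\<forall>i. icoeff p i \<ge> 0) \<and>
    (\<forall>i j. i \<le> j \<longrightarrow> icoeff p (i - 1) * icoeff p (j + 1) \<le> icoeff p i * icoeff p j)"
  have step: "?P ([:1, c:] * p)" if "?P p" "c \<ge> 0" for p c
    using that log_concave_linear_mult[of "icoeff p" c]
    by (simp only: icoeff_linear_mult) (simp add: algebra_simps)
  have "?P (lin_prod a b)"
    by (rule lin_prod_induct) (simp add: icoeff_one, (rule step; simp)+)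
  then show ?thesis using assms by blast
qed

text \<open>Comparison of coefficients in \<open>(1 + x) (1 + 2 x) f' = (2 a + b + 2 (a + b) x) f\<close>.\<close>
lemma icoeff_lin_prod_recurrence:
  "(i + 1) * icoeff (lin_prod a b) (i + 1)
    = (2 * int a + int b - 3 * i) * icoeff (lin_prod a b) i
      + 2 * (int a + int b - i + 1) * icoeff (lin_prod a b) (i - 1)"
proof -
  let ?P = "\<lambda>a b p. \<forall>i. (i + 1) * icoeff p (i + 1)
    = (2 * int a + int b - 3 * i) * icoeff p i + 2 * (int a + int b - i + 1) * icoeff p (i - 1)"
  have "?P a b (lin_prod a b)"
  proof (rule lin_prod_induct[of ?P])
    fix a b p assume *: "?P a b p"
    have "(i + 1) * (icoeff p (i + 1) + 2 * icoeff p i)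
      = (2 * int (Suc a) + int b - 3 * i) * (icoeff p i + 2 * icoeff p (i - 1))
        + 2 * (int (Suc a) + int b - i + 1) * (icoeff p (i - 1) + 2 * icoeff p (i - 2))" for i
      using *[rule_format, of i] *[rule_format, of "i - 1"] by (simp add: algebra_simps)
    then show "?P (Suc a) b ([:1, 2:] * p)"
      by (simp only: icoeff_linear_mult) (simp add: algebra_simps)
    have "(i + 1) * (icoeff p (i + 1) + icoeff p i)
      = (2 * int a + int (Suc b) - 3 * i) * (icoeff p i + icoeff p (i - 1))
        + 2 * (int a + int (Suc b) - i + 1) * (icoeff p (i - 1) + icoeff p (i - 2))" for i
      using *[rule_format, of i] *[rule_format, of "i - 1"] by (simp add: algebra_simps)
    then show "?P a (Suc b) ([:1, 1:] * p)"
      by (simp only: icoeff_linear_mult) (simp add: algebra_simps)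
  qed (simp add: icoeff_one)
  then show ?thesis by blast
qed

text \<open>By log-concavity a drop before \<open>i\<close> forces
  \<open>f (i + 1) \<le> f i\<close>. The recurrence would then give
  \<open>(i + 1) * f i > (A + B) * f i\<close>, although \<open>A + B \<ge> i + 1\<close>.\<close>

lemma icoeff_lin_prod_mono:
  assumes "6 * i \<le> 4 * int a + 3 * int b + 1"
  shows "icoeff (lin_prod a b) (i - 1) \<le> icoeff (lin_prod a b) i"
proof (rule ccontr)
  let ?f = "icoeff (lin_prod a b)"
  define A B where "A = 2 * int a + int b - 3 * i" and "B = 2 * (int a + int b - i + 1)"
  assume "\<not> ?thesis"
  then have less: "?f i < ?f (i - 1)" by simp
  have pos: "?f i \<ge> 0" by (rule icoeff_lin_prod_nonneg)
  then have "i - 1 \<ge> 0" using less by (cases "i - 1 < 0") (simp_all add: icoeff_def)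
  have "?f (i - 1) * ?f (i + 1) \<le> ?f i * ?f i"
    by (rule icoeff_lin_prod_log_concave) simp
  also have "\<dots> \<le> ?f (i - 1) * ?f i"
    using less pos by (intro mult_right_mono) simp_all
  finally have "?f (i + 1) \<le> ?f i" using less pos by simp
  then have "(i + 1) * ?f (i + 1) \<le> (i + 1) * ?f i"
    using \<open>i - 1 \<ge> 0\<close> by (intro mult_left_mono) simp_all
  then have "A * ?f i + B * ?f (i - 1) \<le> (i + 1) * ?f i"
    by (simp only: icoeff_lin_prod_recurrence A_def B_def)
  moreover have "i < int a + int b + 1" using assms by presburger
  then have "B > 0" by (simp add: B_def)
  then have "B * ?f i < B * ?f (i - 1)" using less by simp
  \<comment> \<open>\<open>A + B - (i + 1)\<close> equals \<open>4 a + 3 b + 1 - 6 i\<close>, so its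
    sign is exactly the hypothesis.\<close>
  moreover have "0 \<le> (A + B - (i + 1)) * ?f i"
    using assms pos unfolding A_def B_def by (intro mult_nonneg_nonneg) simp_all
  ultimately show False by (simp add: algebra_simps)
qed

text \<open>Mirror image: a rise after \<open>i\<close> forces \<open>f (i - 1) \<le> f i\<close>,
  and the recurrence then contradicts that rise.\<close>

lemma icoeff_lin_prod_antimono:
  assumes "6 * i \<ge> 4 * int a + 3 * int b + 1"
  shows "icoeff (lin_prod a b) (i + 1) \<le> icoeff (lin_prod a b) i"
proof (rule ccontr)
  let ?f = "icoeff (lin_prod a b)"
  define A B where "A = 2 * int a + int b - 3 * i" and "B = 2 * (int a + int b - i + 1)"
  assume "\<not> ?thesis"
  then have less: "?f i < ?f (i + 1)" by simp
  have pos: "?f i \<ge> 0" "?f (i - 1) \<ge> 0" by (simp_all add: icoeff_lin_prod_nonneg)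
  have "i > 0" using assms by linarith
  have "?f (i - 1) * ?f (i + 1) \<le> ?f i * ?f i"
    by (rule icoeff_lin_prod_log_concave) simp
  also have "\<dots> \<le> ?f i * ?f (i + 1)"
    using less pos by (intro mult_left_mono) simp_all
  finally have le: "?f (i - 1) \<le> ?f i" using less pos by simp
  have rec: "(i + 1) * ?f (i + 1) = A * ?f i + B * ?f (i - 1)"
    by (simp add: icoeff_lin_prod_recurrence A_def B_def)
  have "A * ?f i + B * ?f (i - 1) \<le> (i + 1) * ?f i"
  proof (cases "B \<ge> 0")
    case True
    with le have "B * ?f (i - 1) \<le> B * ?f i" by (rule mult_left_mono)
    moreover have "(A + B - (i + 1)) * ?f i \<le> 0"
      using assms pos unfolding A_def B_def by (intro mult_nonpos_nonneg) simp_all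
    ultimately show ?thesis by (simp add: algebra_simps)
  next
    \<comment> \<open>Now \<open>i\<close> lies beyond the degree. A negative \<open>B\<close> would
      reverse the previous estimate, but both terms of the recurrence are nonpositive here.\<close>
    case False
    then have "A \<le> 0"
      unfolding A_def B_def by arith
    then have "A * ?f i \<le> 0" "B * ?f (i - 1) \<le> 0"
      using False pos by (simp_all add: mult_nonpos_nonneg)
    moreover have "0 \<le> (i + 1) * ?f i" using \<open>i > 0\<close> pos by simp
    ultimately show ?thesis by linarith
  qed
  also have "\<dots> < (i + 1) * ?f (i + 1)" using less \<open>i > 0\<close> by simp
  finally show False using rec by simp
qed

section \<open>Decay of the coefficients to the right of the middle\<close>

lemma icoeff_lin_prod_ratio_le:
  "i * icoeff (lin_prod a b) i \<le> 2 * (int (a + b) - i + 1) * icoeff (lin_prod a b) (i - 1)"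
proof -
  let ?P = "\<lambda>a b p. (\<forall>i. icoeff p i \<ge> 0) \<and>
    (\<forall>i. i * icoeff p i \<le> 2 * (int (a + b) - i + 1) * icoeff p (i - 1))"
  have step: "(\<forall>i. icoeff ([:1, c:] * p) i \<ge> 0) \<and> (\<forall>i. i * icoeff ([:1, c:] * p) i
      \<le> 2 * (int (Suc (a + b)) - i + 1) * icoeff ([:1, c:] * p) (i - 1))"
    if P: "?P a b p" and "0 \<le> c" "c \<le> 2" for a b p c
  proof (intro conjI allI)
    fix i
    \<comment> \<open>The bound \<open>c \<le> 2\<close> pays for raising \<open>a + b\<close> by
      one; the factor \<open>1 + 2 x\<close> is the extremal one.\<close>
    have "c * icoeff p (i - 1) \<le> 2 * icoeff p (i - 1)"
      using P \<open>c \<le> 2\<close> by (intro mult_right_mono) simp_all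
    moreover have "c * ((i - 1) * icoeff p (i - 1))
        \<le> c * (2 * (int (a + b) - (i - 1) + 1) * icoeff p (i - 1 - 1))"
      using P \<open>0 \<le> c\<close> by (intro mult_left_mono) blast+
    moreover have "i * icoeff p i \<le> 2 * (int (a + b) - i + 1) * icoeff p (i - 1)"
      using P by blast
    ultimately have "i * (icoeff p i + c * icoeff p (i - 1))
        \<le> 2 * (int (Suc (a + b)) - i + 1) * (icoeff p (i - 1) + c * icoeff p (i - 1 - 1))"
      by (simp add: algebra_simps)
    then show "i * icoeff ([:1, c:] * p) i
        \<le> 2 * (int (Suc (a + b)) - i + 1) * icoeff ([:1, c:] * p) (i - 1)"
      by (simp only: icoeff_linear_mult)
    show "icoeff ([:1, c:] * p) i \<ge> 0"
      using P \<open>0 \<le> c\<close> by (simp only: icoeff_linear_mult) simp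
  qed
  have "?P a b (lin_prod a b)"
  proof (rule lin_prod_induct[of ?P])
    show "?P (Suc a) b ([:1, 2:] * p)" if "?P a b p" for a b p
      using step[OF that, of 2] by simp
    show "?P a (Suc b) ([:1, 1:] * p)" if "?P a b p" for a b p
      using step[OF that, of 1] by simp
  qed (simp add: icoeff_one)
  then show ?thesis by blast
qed

lemma icoeff_lin_prod_ratio_eq:
  "i * icoeff (lin_prod a 0) i = 2 * (int a - i + 1) * icoeff (lin_prod a 0) (i - 1)"
proof (induction a arbitrary: i)
  case (Suc a)
  from Suc[of i] Suc[of "i - 1"] show ?case
    by (simp add: icoeff_lin_prod_Suc1 algebra_simps)
qed (simp add: lin_prod_0 icoeff_one)

text \<open>Right of the middle \<open>f i \<le> 2 * f (i - 1)\<close>, which is equivalent to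
  \<open>4 * (f i + f (i - 1)) \<le> 3 * (f i + 2 * f (i - 1))\<close>: trading a factor
  \<open>1 + x\<close> for \<open>1 + 2 x\<close> gains at least \<open>4/3\<close>. The trade keeps
  \<open>a + b\<close>, so it can be repeated \<open>b\<close> times.\<close>

lemma icoeff_lin_prod_le:
  assumes "2 * i \<ge> int (a + b)"
  shows "4 ^ b * icoeff (lin_prod a b) i \<le> 3 ^ b * icoeff (lin_prod (a + b) 0) i"
  using assms
proof (induction b arbitrary: a)
  case (Suc b)
  let ?f = "icoeff (lin_prod a b)"
  have pos: "?f (i - 1) \<ge> 0" by (rule icoeff_lin_prod_nonneg)
  have "i > 0" using Suc.prems by simp
  have "i * ?f i \<le> 2 * (int (a + b) - i + 1) * ?f (i - 1)"
    by (rule icoeff_lin_prod_ratio_le)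
  also have "\<dots> \<le> 2 * i * ?f (i - 1)"
    using Suc.prems pos by (intro mult_right_mono) simp_all
  finally have "i * ?f i \<le> i * (2 * ?f (i - 1))" by simp
  then have "?f i \<le> 2 * ?f (i - 1)" using \<open>i > 0\<close> by simp
  then have "4 * icoeff (lin_prod a (Suc b)) i \<le> 3 * icoeff (lin_prod (Suc a) b) i"
    by (simp add: icoeff_lin_prod_Suc1 icoeff_lin_prod_Suc2)
  then have "4 ^ b * (4 * icoeff (lin_prod a (Suc b)) i) \<le> 4 ^ b * (3 * icoeff (lin_prod (Suc a) b) i)"
    by (rule mult_left_mono) simp
  also have "\<dots> \<le> 3 * (3 ^ b * icoeff (lin_prod (Suc a + b) 0) i)"
    using Suc.IH[of "Suc a"] Suc.prems by simp
  finally show ?case by simp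
qed simp

lemma icoeff_lin_prod_le_real:
  assumes "2 * i \<ge> int (a + b)"
  shows "real_of_int (icoeff (lin_prod a b) i)
    \<le> (3 / 4) ^ b * real_of_int (icoeff (lin_prod (a + b) 0) i)"
proof -
  have "real_of_int (4 ^ b * icoeff (lin_prod a b) i)
      \<le> real_of_int (3 ^ b * icoeff (lin_prod (a + b) 0) i)"
    by (simp only: of_int_le_iff icoeff_lin_prod_le[OF assms])
  then show ?thesis by (simp add: power_divide field_simps)
qed

lemma icoeff_lin_prod_drop:
  assumes "2 * i \<ge> int (a + b) + 2"
  shows "real_of_int (icoeff (lin_prod a b) (i - 1) - icoeff (lin_prod a b) i)
    \<le> (3 / 4) ^ b * real_of_int (icoeff (lin_prod (a + b) 0) (i - 1))"
  using icoeff_lin_prod_le_real[of a b "i - 1"] icoeff_lin_prod_nonneg[of a b i] assms by simp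

section \<open>Leading coefficients and growth estimates\<close>

lemma icoeff_lin_prod_top:
  shows icoeff_lin_prod_eq_0: "i > int (a + b) \<Longrightarrow> icoeff (lin_prod a b) i = 0"
    and icoeff_lin_prod_degree: "icoeff (lin_prod a b) (int (a + b)) = 2 ^ a"
proof -
  let ?P = "\<lambda>a b p. (\<forall>i>int (a + b). icoeff p i = 0) \<and> icoeff p (int (a + b)) = 2 ^ a"
  have "?P a b (lin_prod a b)"
    by (rule lin_prod_induct[of ?P]; (simp only: icoeff_linear_mult)?; simp add: icoeff_one)
  then show "i > int (a + b) \<Longrightarrow> icoeff (lin_prod a b) i = 0"
    "icoeff (lin_prod a b) (int (a + b)) = 2 ^ a"
    by blast+
qed

lemma icoeff_lin_prod_penultimate: "icoeff (lin_prod 0 b) (int b - 1) = int b"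
proof (induction b)
  case (Suc b)
  then show ?case
    using icoeff_lin_prod_degree[of 0 b] by (simp add: icoeff_lin_prod_Suc2)
qed (simp add: icoeff_def)

text \<open>The factor \<open>1 + x\<close> makes the increment \<open>e j - e (j - 2)\<close>,
  which is at least \<open>e (j - 1) - e (j - 2)\<close>; the exact ratio of consecutive
  coefficients of \<open>(1 + 2 x) ^ (N + 3)\<close> evaluates the latter.\<close>

lemma linear_power_increment:
  fixes N :: nat and j :: int
  assumes "2 \<le> j" "3 * j \<le> 2 * int N + 7"
  defines "e \<equiv> icoeff (lin_prod (N + 3) 0)"
  shows "6 * e (j - 1)
    \<le> (int N + 8) * (icoeff (lin_prod (N + 3) (Suc 0)) j - icoeff (lin_prod (N + 3) (Suc 0)) (j - 1))"
proof -
  have pos: "e i \<ge> 0" for i by (simp add: e_def icoeff_lin_prod_nonneg)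
  have "j * e j = 2 * (int N + 4 - j) * e (j - 1)"
    using icoeff_lin_prod_ratio_eq[of j "N + 3"] by (simp add: e_def algebra_simps)
  moreover have "j * e (j - 1) \<le> 2 * (int N + 4 - j) * e (j - 1)"
    using assms pos by (intro mult_right_mono) simp_all
  ultimately have "j * e (j - 1) \<le> j * e j" by simp
  then have up: "e (j - 1) \<le> e j" using \<open>2 \<le> j\<close> by simp
  define s where "s = int N + 5 - j"
  have "s > 0" using assms unfolding s_def by linarith
  have eq: "(j - 1) * e (j - 1) = 2 * s * e (j - 2)"
    using icoeff_lin_prod_ratio_eq[of "j - 1" "N + 3"] by (simp add: e_def s_def algebra_simps)
  \<comment> \<open>The constants \<open>6\<close> and \<open>N + 8\<close> are matched: the bound
    on \<open>12 * s\<close> below is the hypothesis on \<open>j\<close> multiplied by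
    \<open>N + 4\<close>.\<close>
  have "3 * (int N + 4) * j \<le> (int N + 4) * (2 * int N + 7)"
    using assms mult_left_mono[of "3 * j" "2 * int N + 7" "int N + 4"] by (simp add: algebra_simps)
  then have "12 * s \<le> (int N + 8) * (2 * int N + 11 - 3 * j)"
    by (simp add: s_def algebra_simps)
  then have "12 * s * e (j - 1) \<le> (int N + 8) * (2 * int N + 11 - 3 * j) * e (j - 1)"
    using pos by (rule mult_right_mono)
  also have "\<dots> = (int N + 8) * (2 * s * e (j - 1) - (j - 1) * e (j - 1))"
    by (simp add: s_def algebra_simps)
  also have "\<dots> = (2 * s) * ((int N + 8) * (e (j - 1) - e (j - 2)))"
    unfolding eq by (simp add: algebra_simps)
  finally have "(2 * s) * (6 * e (j - 1)) \<le> (2 * s) * ((int N + 8) * (e (j - 1) - e (j - 2)))"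
    by simp
  then have "6 * e (j - 1) \<le> (int N + 8) * (e (j - 1) - e (j - 2))"
    using \<open>s > 0\<close> by (simp add: mult_le_cancel_left_pos)
  also have "\<dots> \<le> (int N + 8) * (e j - e (j - 2))"
    using up by (intro mult_left_mono) simp_all
  also have "e j - e (j - 2) = icoeff (lin_prod (N + 3) (Suc 0)) j - icoeff (lin_prod (N + 3) (Suc 0)) (j - 1)"
    by (simp add: e_def icoeff_lin_prod_Suc2)
  finally show ?thesis .
qed

text \<open>The inequality fails at \<open>k = 9\<close>, hence the threshold between the general
  argument and computation.\<close>

lemma three_quarters_power_le:
  fixes k :: nat
  assumes "k \<ge> 10"
  shows "(3 / 4 :: real) ^ k * (real k + 5) \<le> 1"
  using assms
proof (induction k rule: nat_induct_at_least)
  case base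
  show ?case by (simp add: power_divide field_simps)
next
  case (Suc k)
  have "(3 / 4 :: real) ^ Suc k * (real (Suc k) + 5) = (3 / 4) ^ k * (3 / 4 * (real k + 6))"
    by simp
  also have "\<dots> \<le> (3 / 4) ^ k * (real k + 5)"
    by (intro mult_left_mono) simp_all
  finally show ?case using Suc.IH by linarith
qed

text \<open>With \<open>t = 2 ^ l\<close> the linear term is at most \<open>t / 8\<close>. After
  scaling by \<open>64\<close> it remains to compare \<open>(9 + 16 * 2 ^ r) ^ 2\<close> with
  \<open>64 * 34 * 2 ^ r\<close> for the three values of \<open>r\<close>.\<close>

lemma penultimate_estimate:
  fixes l r :: nat
  assumes "r \<le> 2" "l \<ge> 9"
  shows "(2 ^ l + 2 ^ (l + 1 + r) + (2 * int l + r + 13))\<^sup>2 < (17 * 2 ^ (2 * l + r + 1) :: int)"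
proof -
  have "8 * (2 * int l + 15) \<le> 2 ^ l"
    using \<open>l \<ge> 9\<close> by (induction l rule: nat_induct_at_least) simp_all
  then obtain t :: int where t: "2 ^ l = t" "8 * (2 * int l + 15) \<le> t" by blast
  have "0 < t" using t(2) by arith
  have "r = 0 \<or> r = 1 \<or> r = 2" using \<open>r \<le> 2\<close> by linarith
  then have "64 * (t + 2 * 2 ^ r * t + (2 * int l + r + 13))\<^sup>2 < 64 * (17 * (2 * 2 ^ r * t * t))"
  proof -
    have "0 \<le> 8 * (t + 2 * 2 ^ r * t + (2 * int l + r + 13))" using \<open>0 < t\<close> by simp
    moreover have "8 * (t + 2 * 2 ^ r * t + (2 * int l + r + 13)) \<le> (9 + 16 * 2 ^ r) * t"
      using t(2) \<open>r \<le> 2\<close> by (simp add: algebra_simps)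
    ultimately have "(8 * (t + 2 * 2 ^ r * t + (2 * int l + r + 13)))\<^sup>2 \<le> ((9 + 16 * 2 ^ r) * t)\<^sup>2"
      by (rule power_mono[rotated])
    also have "\<dots> = (9 + 16 * 2 ^ r)\<^sup>2 * t\<^sup>2" by (simp only: power_mult_distrib)
    also have "\<dots> < (64 * 17 * (2 * 2 ^ r)) * t\<^sup>2"
      using \<open>r = 0 \<or> r = 1 \<or> r = 2\<close> \<open>0 < t\<close>
      by (intro mult_strict_right_mono) auto
    finally show ?thesis by (simp add: power2_eq_square algebra_simps)
  qed
  moreover have "2 ^ (l + 1 + r) = 2 * 2 ^ r * t" "2 ^ (2 * l + r + 1) = 2 * 2 ^ r * t * t"
    unfolding power_add mult_2[of l] t(1) by simp_all
  ultimately show ?thesis by (simp add: t(1) mult_ac)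
qed

section \<open>The independence polynomial of \<open>U\<^bsub>k,r\<^esub>\<close>\<close>

text \<open>In the paper's notation \<open>l = k - 1\<close> and \<open>n = k + r\<close>.\<close>
definition U_poly :: "nat \<Rightarrow> nat \<Rightarrow> int poly" where
  "U_poly l n = (let t = (\<lambda>s a b. monom 1 s * lin_prod a b) in
     t 0 (l + n + 4) 1 + t 1 (l + n) 4 + t 1 (l + 4) n + t 2 l (n + 4)
     + t 1 (n + 3) (l + 1) + t 2 n (l + 4) + t 2 3 (l + n + 1) + t 3 0 (l + n + 4))"

text \<open>Branch on \<open>Hub 0\<close>. Without it, \<open>Hub 3\<close> and its arms split off,
  and the rest is branched on \<open>Hub 1\<close> and \<open>Hub 2\<close>. Choosing a hub reduces
  its arms to tips, turning factors \<open>1 + 2 x\<close> into \<open>1 + x\<close>.\<close>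

lemma independence_poly_U:
  "independence_poly (U_graph (Suc l) r) = U_poly l (Suc l + r)"
proof -
  define k where "k = Suc l"
  define n where "n = k + r"
  define A where "A i J = Mid i ` J \<union> Tip i ` J" for i and J :: "nat set"
  let ?g = "indep_gf (edges (U_graph k r))"
  let ?X = "[:0, 1:] :: int poly" and ?P = "[:1, 2:] :: int poly" and ?Q = "[:1, 1:] :: int poly"
  have arms: "arms k (k + r) (Suc 0) = 3" "arms k (k + r) 2 = k" "arms k (k + r) 3 = n" "k > 0"
    by (simp_all add: arms_def n_def k_def)
  note [simp] = edges_U arms
  have [simp]: "Tip 2 (Suc 0) \<in> Tip 2 ` {Suc 0..k}" by (auto simp: k_def)
  have l: "k - Suc 0 = l" by (simp add: k_def)
  have gA: "?g (A 1 {1..3}) = ?P ^ 3" "?g (A 2 {1..k}) = ?P ^ k" "?g (A 3 {1..n}) = ?P ^ n"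
    "?g (A 2 {2..k}) = ?P ^ l"
    using indep_gf_arms[of "{1..3}" k r 1] indep_gf_arms[of "{1..k}" k r 2]
      indep_gf_arms[of "{1..n}" k r 3] indep_gf_arms[of "{2..k}" k r 2]
    by (simp_all add: A_def l)
  have gT: "?g (Tip i ` {1..m}) = ?Q ^ m" for i m
    by (simp add: indep_gf_tips)
  have hub2: "?g (insert (Hub 2) (A 2 {1..k})) = ?P ^ k + ?X * ?Q ^ k"
    unfolding gA[symmetric] gT[of 2, symmetric]
    by (rule indep_gf_insert) (auto simp: A_def)
  have hub3: "?g (insert (Hub 3) (A 3 {1..n})) = ?P ^ n + ?X * ?Q ^ n"
    unfolding gA[symmetric] gT[of 3, symmetric]
    by (rule indep_gf_insert) (auto simp: A_def)
  \<comment> \<open>Choosing \<open>Hub 1\<close> also deletes \<open>Mid 2 1\<close> because of the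
    extra edge, so the first arm at \<open>Hub 2\<close> shrinks to its tip.\<close>
  have "?g (insert (Tip 2 1) (A 2 {2..k})) = ?P ^ l + ?X * ?P ^ l"
    unfolding gA[symmetric] by (rule indep_gf_insert) (auto simp: A_def)
  moreover have "?g (insert (Hub 2) (insert (Tip 2 1) (A 2 {2..k})))
      = ?g (insert (Tip 2 1) (A 2 {2..k})) + ?X * ?g (Tip 2 ` {1..k})"
    by (rule indep_gf_insert) (auto simp: A_def)
  ultimately have hub2': "?g (insert (Hub 2) (insert (Tip 2 1) (A 2 {2..k})))
      = ?Q * ?P ^ l + ?X * ?Q ^ k"
    by (simp add: gT[of 2 k, simplified])
  have "?g (A 1 {1..3} \<union> insert (Hub 2) (A 2 {1..k})) = ?P ^ 3 * (?P ^ k + ?X * ?Q ^ k)"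
    unfolding hub2[symmetric] gA(1)[symmetric] by (rule indep_gf_Un) (auto simp: A_def)
  moreover have "?g (Tip 1 ` {1..3} \<union> insert (Hub 2) (insert (Tip 2 1) (A 2 {2..k})))
      = ?Q ^ 3 * (?Q * ?P ^ l + ?X * ?Q ^ k)"
    unfolding hub2'[symmetric] gT[of 1 3, symmetric] by (rule indep_gf_Un) (auto simp: A_def)
  moreover have "?g (insert (Hub 1) (A 1 {1..3} \<union> insert (Hub 2) (A 2 {1..k})))
      = ?g (A 1 {1..3} \<union> insert (Hub 2) (A 2 {1..k}))
        + ?X * ?g (Tip 1 ` {1..3} \<union> insert (Hub 2) (insert (Tip 2 1) (A 2 {2..k})))"
    by (rule indep_gf_insert) (auto simp: A_def)
  ultimately have hub1: "?g (insert (Hub 1) (A 1 {1..3} \<union> insert (Hub 2) (A 2 {1..k})))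
      = ?P ^ 3 * (?P ^ k + ?X * ?Q ^ k) + ?X * (?Q ^ 3 * (?Q * ?P ^ l + ?X * ?Q ^ k))"
    by simp
  have "?g (insert (Hub 1) (A 1 {1..3} \<union> insert (Hub 2) (A 2 {1..k})) \<union> insert (Hub 3) (A 3 {1..n}))
      = ?g (insert (Hub 1) (A 1 {1..3} \<union> insert (Hub 2) (A 2 {1..k}))) * ?g (insert (Hub 3) (A 3 {1..n}))"
    by (rule indep_gf_Un) (auto simp: A_def)
  moreover have "?g (A 1 {1..3} \<union> (A 2 {1..k} \<union> A 3 {1..n})) = ?g (A 1 {1..3}) * ?g (A 2 {1..k} \<union> A 3 {1..n})"
    by (rule indep_gf_Un) (auto simp: A_def)
  moreover have "?g (A 2 {1..k} \<union> A 3 {1..n}) = ?g (A 2 {1..k}) * ?g (A 3 {1..n})"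
    by (rule indep_gf_Un) (auto simp: A_def)
  moreover have "?g (insert (Hub 0) (insert (Hub 1) (A 1 {1..3} \<union> insert (Hub 2) (A 2 {1..k}))
        \<union> insert (Hub 3) (A 3 {1..n})))
      = ?g (insert (Hub 1) (A 1 {1..3} \<union> insert (Hub 2) (A 2 {1..k})) \<union> insert (Hub 3) (A 3 {1..n}))
        + ?X * ?g (A 1 {1..3} \<union> (A 2 {1..k} \<union> A 3 {1..n}))"
    by (rule indep_gf_insert) (auto simp: A_def)
  moreover have "verts (U_graph k r) = insert (Hub 0) (insert (Hub 1) (A 1 {1..3} \<union>
      insert (Hub 2) (A 2 {1..k})) \<union> insert (Hub 3) (A 3 {1..n}))"
  proof -
    have "i \<le> 3 \<longleftrightarrow> i = 0 \<or> i = 1 \<or> i = 2 \<or> i = 3" "i \<in> {1..3} \<longleftrightarrow> i = 1 \<or> i = 2 \<or> i = 3" for i :: nat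
      by auto
    moreover have "Mid i' j \<in> Mid i ` J \<longleftrightarrow> i' = i \<and> j \<in> J" "Tip i' j \<in> Tip i ` J \<longleftrightarrow> i' = i \<and> j \<in> J"
      for i i' j and J :: "nat set"
      by auto
    ultimately have "x \<in> verts (U_graph k r) \<longleftrightarrow> x \<in> insert (Hub 0) (insert (Hub 1) (A 1 {1..3} \<union>
      insert (Hub 2) (A 2 {1..k})) \<union> insert (Hub 3) (A 3 {1..n}))" for x
      by (cases x) (auto simp: U_graph_def add_edge_def T3_def A_def)
    then show ?thesis by blast
  qed
  moreover have "finite (verts (U_graph k r))"
    by (simp add: U_graph_def add_edge_def finite_verts_T3)
  ultimately have "independence_poly (U_graph k r)
      = (?P ^ 3 * (?P ^ k + ?X * ?Q ^ k) + ?X * (?Q ^ 3 * (?Q * ?P ^ l + ?X * ?Q ^ k)))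
        * (?P ^ n + ?X * ?Q ^ n) + ?X * (?P ^ 3 * (?P ^ k * ?P ^ n))"
    by (simp only: independence_poly_eq_indep_gf hub1 hub3 gA)
  also have "\<dots> = U_poly l n"
  proof -
    define X P Q where XPQ: "X = ?X" "P = ?P" "Q = ?Q"
    have Q: "Q = 1 + X" by (simp add: XPQ one_pCons)
    have m: "monom 1 s = X ^ s" for s by (simp add: XPQ monom_altdef)
    \<comment> \<open>The first summand of \<open>U_poly\<close> merges two branches: no hub chosen,
      and only \<open>Hub 0\<close> chosen.\<close>
    have top: "P ^ (l + n + 4) * Q ^ 1 = P ^ (l + n + 4) + X * P ^ (l + n + 4)"
      by (simp add: Q algebra_simps)
    show ?thesis
      unfolding U_poly_def Let_def lin_prod_def m k_def XPQ[symmetric] top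
      by (simp add: power_add algebra_simps power2_eq_square power3_eq_cube power4_eq_xxxx)
  qed
  finally show ?thesis by (simp add: k_def n_def)
qed

section \<open>Unimodality for large \<open>k\<close>\<close>

lemma icoeff_U_poly:
  "icoeff (U_poly l n) j =
     icoeff (lin_prod (l + n + 4) 1) j + icoeff (lin_prod (l + n) 4) (j - 1)
     + icoeff (lin_prod (l + 4) n) (j - 1) + icoeff (lin_prod l (n + 4)) (j - 2)
     + icoeff (lin_prod (n + 3) (l + 1)) (j - 1) + icoeff (lin_prod n (l + 4)) (j - 2)
     + icoeff (lin_prod 3 (l + n + 1)) (j - 2) + icoeff (lin_prod 0 (l + n + 4)) (j - 3)"
  by (simp add: U_poly_def Let_def icoeff_add icoeff_monom_mult)

text \<open>The summand \<open>lin_prod (l + n + 4) 1\<close> dictates the threshold; for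
  \<open>l \<ge> 9\<close> the others are already falling.\<close>

lemma U_poly_antimono:
  assumes "l \<ge> 9" "n \<ge> l" "6 * j \<ge> 4 * int (l + n) + 20"
  shows "icoeff (U_poly l n) (j + 1) \<le> icoeff (U_poly l n) j"
proof -
  note le = icoeff_lin_prod_antimono
  have "icoeff (lin_prod (l + n + 4) 1) (j + 1) \<le> icoeff (lin_prod (l + n + 4) 1) j"
    using assms by (intro le) simp
  moreover have "icoeff (lin_prod (l + n) 4) (j - 1 + 1) \<le> icoeff (lin_prod (l + n) 4) (j - 1)"
    using assms by (intro le) simp
  moreover have "icoeff (lin_prod (l + 4) n) (j - 1 + 1) \<le> icoeff (lin_prod (l + 4) n) (j - 1)"
    using assms by (intro le) simp
  moreover have "icoeff (lin_prod l (n + 4)) (j - 2 + 1) \<le> icoeff (lin_prod l (n + 4)) (j - 2)"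
    using assms by (intro le) simp
  moreover have "icoeff (lin_prod (n + 3) (l + 1)) (j - 1 + 1) \<le> icoeff (lin_prod (n + 3) (l + 1)) (j - 1)"
    using assms by (intro le) simp
  moreover have "icoeff (lin_prod n (l + 4)) (j - 2 + 1) \<le> icoeff (lin_prod n (l + 4)) (j - 2)"
    using assms by (intro le) simp
  moreover have "icoeff (lin_prod 3 (l + n + 1)) (j - 2 + 1) \<le> icoeff (lin_prod 3 (l + n + 1)) (j - 2)"
    using assms by (intro le) simp
  moreover have "icoeff (lin_prod 0 (l + n + 4)) (j - 3 + 1) \<le> icoeff (lin_prod 0 (l + n + 4)) (j - 3)"
    using assms by (intro le) simp
  ultimately show ?thesis by (simp add: icoeff_U_poly)
qed

text \<open>The tightest summand is the shift of \<open>lin_prod 3 (l + n + 1)\<close> by two, which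
  rises while \<open>6 * j \<le> 3 * (l + n) + 28\<close>.\<close>

lemma U_poly_mono_left:
  assumes "l \<ge> 9" "n \<ge> l" "2 * j \<le> int (l + n) + 9"
  shows "icoeff (U_poly l n) (j - 1) \<le> icoeff (U_poly l n) j"
proof -
  note le = icoeff_lin_prod_mono
  have "icoeff (lin_prod (l + n + 4) 1) (j - 1) \<le> icoeff (lin_prod (l + n + 4) 1) j"
    using assms by (intro le) simp
  moreover have "icoeff (lin_prod (l + n) 4) (j - 1 - 1) \<le> icoeff (lin_prod (l + n) 4) (j - 1)"
    using assms by (intro le) simp
  moreover have "icoeff (lin_prod (l + 4) n) (j - 1 - 1) \<le> icoeff (lin_prod (l + 4) n) (j - 1)"
    using assms by (intro le) simp
  moreover have "icoeff (lin_prod l (n + 4)) (j - 2 - 1) \<le> icoeff (lin_prod l (n + 4)) (j - 2)"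
    using assms by (intro le) simp
  moreover have "icoeff (lin_prod (n + 3) (l + 1)) (j - 1 - 1) \<le> icoeff (lin_prod (n + 3) (l + 1)) (j - 1)"
    using assms by (intro le) simp
  moreover have "icoeff (lin_prod n (l + 4)) (j - 2 - 1) \<le> icoeff (lin_prod n (l + 4)) (j - 2)"
    using assms by (intro le) simp
  moreover have "icoeff (lin_prod 3 (l + n + 1)) (j - 2 - 1) \<le> icoeff (lin_prod 3 (l + n + 1)) (j - 2)"
    using assms by (intro le) simp
  moreover have "icoeff (lin_prod 0 (l + n + 4)) (j - 3 - 1) \<le> icoeff (lin_prod 0 (l + n + 4)) (j - 3)"
    using assms by (intro le) simp
  ultimately show ?thesis by (simp add: icoeff_U_poly)
qed

text \<open>The second summand still rises, and the growth of the first outweighs the possible drops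
  \<open>dec\<close> of the other six. Everything is measured against
  \<open>e (j - 1)\<close>.\<close>

lemma U_poly_mono_right:
  assumes "l \<ge> 9" "l + 1 \<le> n" "n \<le> l + 3" "2 * j \<ge> int (l + n) + 10" "3 * j \<le> 2 * int (l + n) + 9"
  shows "icoeff (U_poly l n) (j - 1) \<le> icoeff (U_poly l n) j"
proof -
  define e where "e = (\<lambda>i. real_of_int (icoeff (lin_prod (l + n + 4) 0) i))"
  define dec where "dec = (\<lambda>a b i. real_of_int (icoeff (lin_prod a b) (i - 1) - icoeff (lin_prod a b) i))"
  \<comment> \<open>\<open>l + 1\<close> is the least number of factors \<open>1 + x\<close> among
    the six small summands.\<close>
  define q :: real where "q = (3 / 4) ^ (l + 1)"
  have e_nonneg: "e i \<ge> 0" for i by (simp add: e_def icoeff_lin_prod_nonneg)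
  have e_step: "e (i - 1) \<le> e i" if "i \<le> j - 1" for i
    using that assms by (simp add: e_def icoeff_lin_prod_mono)
  have e2: "e (j - 2) \<le> e (j - 1)" using e_step[of "j - 1"] by simp
  moreover have "e (j - 3) \<le> e (j - 2)" using e_step[of "j - 2"] by simp
  moreover have "e (j - 4) \<le> e (j - 3)" using e_step[of "j - 3"] by simp
  ultimately have e3: "e (j - 3) \<le> e (j - 1)" and e4: "e (j - 4) \<le> e (j - 1)" by simp_all
  have decay: "dec a b i \<le> (3 / 4) ^ b * e (j - 1)"
    if "a + b = l + n + 4" "i = j - 1 \<or> i = j - 2" for a b i
  proof -
    have "dec a b i \<le> (3 / 4) ^ b * e (i - 1)"
      unfolding dec_def e_def that(1)[symmetric]
      by (rule icoeff_lin_prod_drop) (use that assms in auto)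
    also have "\<dots> \<le> (3 / 4) ^ b * e (j - 1)"
      using that(2) e2 e3 by (intro mult_left_mono) auto
    finally show ?thesis .
  qed
  have qle: "(3 / 4 :: real) ^ b \<le> q * (3 / 4) ^ c" if "b \<ge> l + 1 + c" for b c
    unfolding q_def power_add[symmetric] using that by (rule power_decreasing) simp_all
  have step: "dec a b i \<le> (q * (3 / 4) ^ c) * e (j - 1)"
    if "a + b = l + n + 4" "i = j - 1 \<or> i = j - 2" "b \<ge> l + 1 + c" for a b c i
    using decay[OF that(1,2)] mult_right_mono[OF qle[OF that(3)] e_nonneg[of "j - 1"]] by linarith
  \<comment> \<open>Here \<open>j - 4\<close> is too small for \<open>icoeff_lin_prod_drop\<close>, so the bound goes through the
    coefficient of \<open>(1 + x) ^ (l + n + 5)\<close> at \<open>j - 3\<close>.\<close>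
  have c6: "dec 0 (l + n + 4) (j - 3) \<le> 3 * (q * (3 / 4) ^ 10) * e (j - 1)"
  proof (cases "2 * j \<le> int (l + n) + 10")
    case True
    then have "dec 0 (l + n + 4) (j - 3) \<le> 0"
      using icoeff_lin_prod_mono[of "j - 3" 0 "l + n + 4"] by (simp add: dec_def)
    also have "0 \<le> 3 * (q * (3 / 4) ^ 10) * e (j - 1)" by (simp add: q_def e_nonneg)
    finally show ?thesis .
  next
    case False
    have "real_of_int (icoeff (lin_prod 0 (l + n + 5)) (j - 3))
        \<le> (3 / 4) ^ (l + n + 5) * real_of_int (icoeff (lin_prod (l + n + 5) 0) (j - 3))"
      using False icoeff_lin_prod_le_real[of 0 "l + n + 5" "j - 3"] by simp
    also have "real_of_int (icoeff (lin_prod (l + n + 5) 0) (j - 3)) = e (j - 3) + 2 * e (j - 4)"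
      using icoeff_lin_prod_Suc1[of "l + n + 4" 0 "j - 3"] by (simp add: e_def eval_nat_numeral)
    also have "(3 / 4) ^ (l + n + 5) * (e (j - 3) + 2 * e (j - 4)) \<le> (q * (3 / 4) ^ 10) * (3 * e (j - 1))"
      using e3 e4 e_nonneg assms by (intro mult_mono qle) (simp_all add: q_def)
    finally have "real_of_int (icoeff (lin_prod 0 (l + n + 5)) (j - 3)) \<le> 3 * (q * (3 / 4) ^ 10) * e (j - 1)"
      by simp
    moreover have "dec 0 (l + n + 4) (j - 3) \<le> real_of_int (icoeff (lin_prod 0 (l + n + 5)) (j - 3))"
      using icoeff_lin_prod_Suc2[of 0 "l + n + 4" "j - 3"] icoeff_lin_prod_nonneg[of 0 "l + n + 4" "j - 3"]
      by (simp add: dec_def eval_nat_numeral)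
    ultimately show ?thesis by linarith
  qed
  \<comment> \<open>Each power of \<open>3 / 4\<close> beside \<open>q\<close> counts guaranteed
    factors \<open>1 + x\<close> beyond \<open>l + 1\<close>, using \<open>n \<ge> l + 1\<close> and
    \<open>l \<ge> 9\<close>.\<close>
  have "dec (l + 4) n (j - 1) \<le> (q * (3 / 4) ^ 0) * e (j - 1)"
    "dec l (n + 4) (j - 2) \<le> (q * (3 / 4) ^ 4) * e (j - 1)"
    "dec (n + 3) (l + 1) (j - 1) \<le> (q * (3 / 4) ^ 0) * e (j - 1)"
    "dec n (l + 4) (j - 2) \<le> (q * (3 / 4) ^ 3) * e (j - 1)"
    "dec 3 (l + n + 1) (j - 2) \<le> (q * (3 / 4) ^ 10) * e (j - 1)"
    using assms by (intro step; simp)+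
  moreover have "q * e (j - 1) \<ge> 0" by (simp add: q_def e_nonneg)
  \<comment> \<open>The weights \<open>2 + (3/4)^4 + (3/4)^3 + 4 * (3/4)^10\<close> sum to just
    under \<open>3\<close>.\<close>
  ultimately have corrections: "dec (l + 4) n (j - 1) + dec l (n + 4) (j - 2) + dec (n + 3) (l + 1) (j - 1)
      + dec n (l + 4) (j - 2) + dec 3 (l + n + 1) (j - 2) + dec 0 (l + n + 4) (j - 3) \<le> 3 * (q * e (j - 1))"
    using c6 by (simp add: power_divide field_simps)
  have "(3 / 4 :: real) ^ (l + 1) * (real (l + 1) + 5) \<le> 1"
    using assms by (intro three_quarters_power_le) simp
  then have "q * (real l + 6) \<le> 1" by (simp add: q_def add.commute)
  moreover have "q * real n \<le> q * (real l + 3)" using assms by (intro mult_left_mono) (simp_all add: q_def)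
  ultimately have "q * real (l + n + 9) \<le> 2" by (simp add: algebra_simps)
  then have "3 * (q * real (l + n + 9)) * e (j - 1) \<le> 6 * e (j - 1)"
    using e_nonneg by (intro mult_right_mono) simp_all
  \<comment> \<open>Here \<open>N = l + n + 1\<close>, so the factor \<open>N + 8\<close> becomes
    \<open>l + n + 9\<close>.\<close>
  also have "real_of_int (6 * icoeff (lin_prod (l + n + 1 + 3) 0) (j - 1))
      \<le> real_of_int ((int (l + n + 1) + 8) * (icoeff (lin_prod (l + n + 1 + 3) (Suc 0)) j
        - icoeff (lin_prod (l + n + 1 + 3) (Suc 0)) (j - 1)))"
    using assms by (intro iffD2[OF of_int_le_iff] linear_power_increment) simp_all
  then have "6 * e (j - 1) \<le> real (l + n + 9) * - dec (l + n + 4) 1 j"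
    by (simp add: e_def dec_def algebra_simps)
  finally have "real (l + n + 9) * (3 * (q * e (j - 1))) \<le> real (l + n + 9) * - dec (l + n + 4) 1 j"
    by (simp add: algebra_simps)
  then have main: "3 * (q * e (j - 1)) \<le> - dec (l + n + 4) 1 j"
    by (rule mult_left_le_imp_le) simp
  have "dec (l + n) 4 (j - 1) \<le> 0"
    using icoeff_lin_prod_mono[of "j - 1" "l + n" 4] assms by (simp add: dec_def)
  with main corrections have "real_of_int (icoeff (U_poly l n) (j - 1)) \<le> real_of_int (icoeff (U_poly l n) j)"
    by (simp add: icoeff_U_poly dec_def)
  then show ?thesis by simp
qed

lemma unimodalI:
  fixes m :: nat
  assumes "m < degree p"
    and mono: "\<And>i. i < m \<Longrightarrow> coeff p i \<le> coeff p (i + 1)"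
    and anti: "\<And>i. m < i \<Longrightarrow> coeff p (i + 1) \<le> coeff p i"
  shows "unimodal p"
proof (cases "coeff p m \<le> coeff p (m + 1)")
  case True
  then have "coeff p i \<le> coeff p (i + 1)" if "i < m + 1" for i
    using mono[of i] that by (cases "i = m") simp_all
  then show ?thesis
    unfolding unimodal_def using assms by (intro exI[of _ "m + 1"]) auto
next
  case False
  then have "coeff p (i + 1) \<le> coeff p i" if "m \<le> i" for i
    using anti[of i] that by (cases "i = m") simp_all
  then show ?thesis
    unfolding unimodal_def using assms by (intro exI[of _ m]) auto
qed

text \<open>Only the last summand has degree \<open>l + n + 7\<close>. Three summands of degree
  \<open>l + n + 6\<close> contribute \<open>2 ^ l\<close>, \<open>2 ^ n\<close> and
  \<open>8\<close>, the last one adds \<open>l + n + 4\<close>. The first two summands alone give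
  \<open>(16 + 1) * 2 ^ (l + n)\<close> one index lower.\<close>

lemma U_poly_top:
  shows "degree (U_poly l n) = l + n + 7"
    and "coeff (U_poly l n) (l + n + 7) = 1"
    and "coeff (U_poly l n) (l + n + 6) = 2 ^ l + 2 ^ n + int (l + n + 12)"
    and "coeff (U_poly l n) (l + n + 5) \<ge> 17 * 2 ^ (l + n)"
proof -
  show c: "coeff (U_poly l n) (l + n + 7) = 1"
    using icoeff_lin_prod_degree[of 0 "l + n + 4"]
    by (simp add: coeff_eq_icoeff icoeff_U_poly icoeff_lin_prod_eq_0 add_ac)
  have "coeff (U_poly l n) i = 0" if "i > l + n + 7" for i
    using that by (simp add: coeff_eq_icoeff icoeff_U_poly icoeff_lin_prod_eq_0)
  then have "degree (U_poly l n) \<le> l + n + 7" by (intro degree_le) blast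
  moreover have "l + n + 7 \<le> degree (U_poly l n)" using c by (intro le_degree) simp
  ultimately show "degree (U_poly l n) = l + n + 7" by simp
  show "coeff (U_poly l n) (l + n + 6) = 2 ^ l + 2 ^ n + int (l + n + 12)"
    using icoeff_lin_prod_degree[of l "n + 4"] icoeff_lin_prod_degree[of n "l + 4"]
      icoeff_lin_prod_degree[of 3 "l + n + 1"] icoeff_lin_prod_penultimate[of "l + n + 4"]
    by (simp add: coeff_eq_icoeff icoeff_U_poly icoeff_lin_prod_eq_0 add_ac)
  have "2 ^ (l + n + 4) + 2 ^ (l + n) \<le> icoeff (U_poly l n) (int (l + n + 5))"
    using icoeff_lin_prod_degree[of "l + n + 4" 1] icoeff_lin_prod_degree[of "l + n" 4]
    by (simp add: icoeff_U_poly icoeff_lin_prod_nonneg add_ac)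
  then show "coeff (U_poly l n) (l + n + 5) \<ge> 17 * 2 ^ (l + n)"
    by (simp add: coeff_eq_icoeff power_add)
qed

section \<open>Small cases and conclusion\<close>

fun up_down :: "'a::linorder list \<Rightarrow> bool" where
  "up_down (x # y # xs) = (if x \<le> y then up_down (y # xs) else successively (\<ge>) (y # xs))"
| "up_down xs = True"

lemma up_downD:
  assumes "up_down xs"
  shows "\<exists>m\<le>length xs - 1. (\<forall>i<m. xs ! i \<le> xs ! (i + 1)) \<and>
    (\<forall>i. m \<le> i \<and> i < length xs - 1 \<longrightarrow> xs ! (i + 1) \<le> xs ! i)"
  using assms
proof (induction xs rule: up_down.induct)
  case (1 x y xs)
  show ?case
  proof (cases "x \<le> y")
    case True
    with 1 obtain m where m: "m \<le> length xs" "\<And>i. i < m \<Longrightarrow> (y # xs) ! i \<le> (y # xs) ! (i + 1)"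
      "\<And>i. m \<le> i \<Longrightarrow> i < length xs \<Longrightarrow> (y # xs) ! (i + 1) \<le> (y # xs) ! i"
      by auto
    show ?thesis
    proof (intro exI[of _ "Suc m"] conjI allI impI)
      fix i assume "i < Suc m"
      with m(2) True show "(x # y # xs) ! i \<le> (x # y # xs) ! (i + 1)"
        by (cases i) simp_all
    next
      fix i assume "Suc m \<le> i \<and> i < length (x # y # xs) - 1"
      with m(3) show "(x # y # xs) ! (i + 1) \<le> (x # y # xs) ! i"
        by (cases i) simp_all
    qed (use m(1) in simp)
  next
    case False
    with 1 have "successively (\<ge>) (x # y # xs)" by simp
    then have "\<forall>i. Suc i < length (x # y # xs) \<longrightarrow> (x # y # xs) ! i \<ge> (x # y # xs) ! Suc i"
      by (simp only: successively_conv_nth)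
    then show ?thesis by (intro exI[of _ 0]) simp
  qed
qed simp_all

text \<open>The length condition rules out trailing zeros, which \<open>Poly\<close> would
  strip.\<close>

lemma unimodal_Poly:
  assumes "up_down xs" "length xs = Suc (degree (Poly xs))"
  shows "unimodal (Poly xs)"
proof -
  let ?d = "degree (Poly xs)"
  obtain m where m: "m \<le> ?d" "\<And>i. i < m \<Longrightarrow> xs ! i \<le> xs ! (i + 1)"
    "\<And>i. m \<le> i \<Longrightarrow> i < ?d \<Longrightarrow> xs ! (i + 1) \<le> xs ! i"
    using up_downD[OF assms(1)] assms(2) by auto
  have "coeff (Poly xs) i = xs ! i" if "i \<le> ?d" for i
    using that assms(2) by (simp add: coeff_Poly_eq nth_default_nth)
  with m show ?thesis unfolding unimodal_def by (intro exI[of _ m]) simp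
qed

fun add_lists :: "int list \<Rightarrow> int list \<Rightarrow> int list" where
  "add_lists (x # xs) (y # ys) = (x + y) # add_lists xs ys"
| "add_lists xs [] = xs"
| "add_lists [] ys = ys"

fun linear_mult_list :: "int \<Rightarrow> nat \<Rightarrow> int list \<Rightarrow> int list" where
  "linear_mult_list c 0 xs = xs"
| "linear_mult_list c (Suc n) xs = linear_mult_list c n (add_lists xs (0 # map ((*) c) xs))"

text \<open>
  \<open>code_simp\<close> evaluates these list versions quickly because none of the code equations
  contains a \<open>let\<close>-bound function or an abstraction it would normalise symbolically.
\<close>
definition lin_prod_list :: "nat \<Rightarrow> nat \<Rightarrow> nat \<Rightarrow> int list" where
  "lin_prod_list s a b = replicate s 0 @ linear_mult_list 2 a (linear_mult_list 1 b [1])"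

definition U_list :: "nat \<Rightarrow> nat \<Rightarrow> int list" where
  "U_list l n =
     add_lists (lin_prod_list 0 (l + n + 4) 1) (add_lists (lin_prod_list 1 (l + n) 4)
     (add_lists (lin_prod_list 1 (l + 4) n) (add_lists (lin_prod_list 2 l (n + 4))
     (add_lists (lin_prod_list 1 (n + 3) (l + 1)) (add_lists (lin_prod_list 2 n (l + 4))
     (add_lists (lin_prod_list 2 3 (l + n + 1)) (lin_prod_list 3 0 (l + n + 4))))))))"

lemma Poly_add_lists: "Poly (add_lists xs ys) = Poly xs + Poly ys"
  by (induction xs ys rule: add_lists.induct) simp_all

lemma Poly_linear_mult_list: "Poly (linear_mult_list c n xs) = [:1, c:] ^ n * Poly xs"
proof (induction c n xs rule: linear_mult_list.induct)
  case (2 c n xs)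
  have "Poly (map ((*) c) xs) = smult c (Poly xs)" by (induction xs) simp_all
  with 2 show ?case by (simp add: Poly_add_lists algebra_simps)
qed simp

lemma Poly_U_list: "Poly (U_list l n) = U_poly l n"
proof -
  have "Poly (replicate s 0 @ xs) = monom 1 s * Poly xs" for s and xs :: "int list"
    by (induction s) (simp_all add: monom_0 monom_Suc)
  then show ?thesis
    by (simp only: U_list_def lin_prod_list_def U_poly_def Let_def lin_prod_def Poly_add_lists Poly_linear_mult_list
        Poly.simps pCons_0_0 one_pCons[symmetric] mult_1_right
        add_0_right add.assoc)
qed

text \<open>The last test omits the leading coefficient, which is \<open>1\<close> by
  \<open>U_poly_top\<close>.\<close>

definition U_list_ok :: "nat \<Rightarrow> nat \<Rightarrow> bool" where
  "U_list_ok l n \<longleftrightarrow> (let xs = U_list l n in length xs = l + n + 8 \<and> up_down xs \<and>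
     (xs ! (l + n + 6))\<^sup>2 < xs ! (l + n + 5))"

text \<open>The pairs are \<open>(l, l + 1 + r)\<close> for \<open>2 \<le> l \<le> 8\<close> and
  \<open>r \<le> 2\<close>, without the excluded case \<open>(2, 5)\<close>.\<close>

lemma U_list_ok_small_cases:
  "list_all (case_prod U_list_ok)
     [(2, 3), (2, 4), (3, 4), (3, 5), (3, 6), (4, 5), (4, 6), (4, 7), (5, 6), (5, 7), (5, 8),
      (6, 7), (6, 8), (6, 9), (7, 8), (7, 9), (7, 10), (8, 9), (8, 10), (8, 11)]"
  by code_simp

lemma U_poly_unimodal_and_penultimate:
  assumes "r \<le> 2" "l \<ge> 2" "(l, r) \<noteq> (2, 2)"
  defines "p \<equiv> U_poly l (l + 1 + r)"
  shows "unimodal p \<and> (coeff p (degree p - 1))\<^sup>2 < coeff p (degree p - 2) * coeff p (degree p)"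
proof (cases "l \<ge> 9")
  case True
  let ?n = "l + 1 + r"
  \<comment> \<open>This is \<open>(2 N + 7) div 3\<close> with
    \<open>N = l + ?n + 1\<close>.\<close>
  define m where "m = (2 * (l + ?n) + 9) div 3"
  have "unimodal p"
  proof (rule unimodalI[of m])
    show "m < degree p" unfolding p_def U_poly_top(1) m_def by arith
  next
    fix i assume "i < m"
    then have *: "3 * (int i + 1) \<le> 2 * int (l + ?n) + 9" unfolding m_def by arith
    have "icoeff p (int i + 1 - 1) \<le> icoeff p (int i + 1)"
      unfolding p_def
    proof (cases "2 * (int i + 1) \<le> int (l + ?n) + 9")
      case True
      then show "icoeff (U_poly l ?n) (int i + 1 - 1) \<le> icoeff (U_poly l ?n) (int i + 1)"
        using \<open>l \<ge> 9\<close> by (intro U_poly_mono_left) simp_all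
    next
      case False
      then show "icoeff (U_poly l ?n) (int i + 1 - 1) \<le> icoeff (U_poly l ?n) (int i + 1)"
        using \<open>l \<ge> 9\<close> \<open>r \<le> 2\<close> * by (intro U_poly_mono_right) simp_all
    qed
    then show "coeff p i \<le> coeff p (i + 1)" by (simp add: coeff_eq_icoeff add.commute)
  next
    fix i assume "m < i"
    then have "6 * int i \<ge> 4 * int (l + ?n) + 20" unfolding m_def by arith
    then have "icoeff p (int i + 1) \<le> icoeff p (int i)"
      using \<open>l \<ge> 9\<close> unfolding p_def by (intro U_poly_antimono) simp_all
    then show "coeff p (i + 1) \<le> coeff p i" by (simp add: coeff_eq_icoeff add.commute)
  qed
  moreover have "(coeff p (degree p - 1))\<^sup>2 < coeff p (degree p - 2) * coeff p (degree p)"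
  proof -
    have "degree p = l + ?n + 7" by (simp add: p_def U_poly_top(1))
    then have deg: "degree p - 1 = l + ?n + 6" "degree p - 2 = l + ?n + 5" "degree p = l + ?n + 7"
      by simp_all
    have "(coeff p (l + ?n + 6))\<^sup>2 < 17 * 2 ^ (l + ?n)"
    proof -
      have "l + ?n = 2 * l + r + 1" "int (l + ?n + 12) = 2 * int l + int r + 13" by simp_all
      then show ?thesis
        using penultimate_estimate[OF \<open>r \<le> 2\<close> True]
        unfolding p_def U_poly_top(3) by (simp only:)
    qed
    also have "\<dots> \<le> coeff p (l + ?n + 5)" unfolding p_def by (rule U_poly_top(4))
    finally show ?thesis unfolding deg using U_poly_top(2)[of l ?n] by (simp add: p_def)
  qed
  ultimately show ?thesis ..
next
  case False
  define xs where "xs = U_list l (l + 1 + r)"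
  have "l = 2 \<or> l = 3 \<or> l = 4 \<or> l = 5 \<or> l = 6 \<or> l = 7 \<or> l = 8" "r = 0 \<or> r = 1 \<or> r = 2"
    using False assms(1,2) by presburger+
  then have "U_list_ok l (l + 1 + r)"
    using U_list_ok_small_cases assms(3) by (elim disjE) simp_all
  then have xs: "length xs = l + (l + 1 + r) + 8" "up_down xs"
    "(xs ! (l + (l + 1 + r) + 6))\<^sup>2 < xs ! (l + (l + 1 + r) + 5)"
    by (simp_all only: U_list_ok_def Let_def xs_def)
  have p: "p = Poly xs" by (simp add: p_def xs_def Poly_U_list)
  have "degree p = l + (l + 1 + r) + 7" by (simp add: p_def U_poly_top(1))
  then have deg: "degree p - 1 = l + (l + 1 + r) + 6" "degree p - 2 = l + (l + 1 + r) + 5"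
    "degree p = l + (l + 1 + r) + 7"
    by simp_all
  have nth: "coeff p i = xs ! i" if "i < length xs" for i
    using that by (simp add: p coeff_Poly_eq nth_default_nth)
  have "unimodal p"
    unfolding p by (rule unimodal_Poly) (use xs deg in \<open>simp_all add: p[symmetric]\<close>)
  moreover have "(coeff p (l + (l + 1 + r) + 6))\<^sup>2 < coeff p (l + (l + 1 + r) + 5)"
    using xs by (simp add: nth)
  ultimately show ?thesis
    unfolding deg using U_poly_top(2)[of l "l + 1 + r"] by (simp add: p_def)
qed

theorem mainTheorem1:
  fixes k r :: nat
  assumes "r \<in> {0, 1, 2}"
    and "k \<ge> 3"
    and "r = 2 \<Longrightarrow> k \<ge> 4"
  shows "let p = independence_poly (U_graph k r); d = independence_number (U_graph k r) in
           unimodal p \<and> \<not> log_concave p \<and>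
           (coeff p (d - 1))\<^sup>2 < coeff p (d - 2) * coeff p d"
proof -
  define p where "p = independence_poly (U_graph k r)"
  have "finite (verts (U_graph k r))"
    by (simp add: U_graph_def add_edge_def finite_verts_T3)
  then have d: "independence_number (U_graph k r) = degree p"
    by (simp add: p_def degree_independence_poly)
  define l where "l = k - 1"
  have l: "k = Suc l" "l \<ge> 2" "r \<le> 2" "(l, r) \<noteq> (2, 2)"
    using assms by (auto simp: l_def)
  then have "p = U_poly l (l + 1 + r)"
    by (simp add: p_def independence_poly_U)
  then have *: "unimodal p" "(coeff p (degree p - 1))\<^sup>2 < coeff p (degree p - 2) * coeff p (degree p)"
    using U_poly_unimodal_and_penultimate[OF l(3,2,4)] by simp_all
  \<comment> \<open>This keeps the natural-number subtractions from truncating and makes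
    \<open>degree p - 1\<close> an admissible index in \<open>log_concave\<close>.\<close>
  have "degree p \<ge> 2" using independence_number_U[of k r] d by simp
  then have "degree p - 1 - 1 = degree p - 2" "degree p - 1 + 1 = degree p" "1 \<le> degree p - 1"
    "degree p - 1 < degree p" by simp_all
  with *(2) have "\<not> log_concave p"
    unfolding log_concave_def by (metis not_less)
  with * show ?thesis
    unfolding Let_def p_def[symmetric] d by blast
qed

end
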